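(* Let $G=(V,E)$ be a clique star with $V=C_1\sqcup\dots\sqcup C_k\sqcup S$, let $(d_v)_{v\in V}$ be the numbers of states, and let $r\ge1$. Let $\mathcal{M}_{C_1\perp\!\!\!\perp\cdots\perp\!\!\!\perp C_k}$ denote the independence model on $k$ random variables whose state spaces have sizes $d_{C_1},\dots,d_{C_k}$, respectively. Then $$\mathrm{MLdeg}\big(\mathrm{Mixt}^r(\mathcal{M}_G)\big)=\Big(\mathrm{MLdeg}\big(\mathrm{Mixt}^r(\mathcal{M}_{C_1\perp\!\!\!\perp\cdots\perp\!\!\!\perp C_k})\big)\Big)^{d_S}.$$
   Context: $G=(V,E)$ is a finite simple undirected graph; each $v\in V$ carries a positive integer $d_v$ (number of states). Write $[n]=\{1,\dots,n\}$; for $A\subseteq V$ let $\mathcal{R}_A=\prod_{v\in A}[d_v]$, $d_A=\prod_{v\in A}d_v$ (so $d_\emptyset=1$), $\mathcal{R}=\mathcal{R}_V$; for $i\in\mathcal{R}$, $i_A$ is its restriction to $A$. A clique is a (possibly empty) set of pairwise adjacent vertices; $\mathcal{C}(G)$ is the set of (inclusion-)maximal cliques. Clique star: $G$ is a clique star if it is a union of its maximal cliques $\widetilde C_1,\dots,\widetilde C_k$ and there is a (possibly empty) clique $S$ with $\widetilde C_i\cap\widetilde C_j=S$ for all $i\ne j$. Put $C_i=\widetilde C_i\setminus S$, so $V=C_1\sqcup\dots\sqcup C_k\sqcup S$. $\Delta_n=\{p\in\mathbb{R}^n : p_i>0,\ p_1+\dots+p_n=1\}$. With $m=\sum_{C\in\mathcal{C}(G)}d_C$,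 the monomial map $\phi^G:\mathbb{C}^m\to\mathbb{C}^{|\mathcal{R}|}$ is $\phi^G_i(\theta)=\prod_{C\in\mathcal{C}(G)}\theta^{(C)}_{i_C}$, and $\mathcal{M}_G=\phi^G(\mathbb{C}^m)\cap\Delta_{|\mathcal{R}|}$. The independence model $\mathcal{M}_{C_1\perp\!\!\!\perp\cdots\perp\!\!\!\perp C_k}$ is the set of $d_{C_1}\times\cdots\times d_{C_k}$ tensors of rank one in the open simplex $\Delta_{d_{C_1}\cdots d_{C_k}}$. For a model $\mathcal{M}$, $$\mathrm{Mixt}^r(\mathcal{M})=\{\pi_1p^1+\dots+\pi_rp^r : (\pi_1,\dots,\pi_r)\in\Delta_r,\ p^1,\dots,p^r\in\mathcal{M}\}.$$ The maximum likelihood degree $\mathrm{MLdeg}(\mathcal{M})$ of a model $\mathcal{M}\subseteq\Delta_n$ is the number of complex critical points of the log-likelihood function $\ell_u(p)=\sum_{i=1}^n u_i\log(p_i)$ on the Zariski closure of $\mathcal{M}$ (inside $\{\sum_i p_i=1\}\subset\mathbb{C}^n$) for generic data $u\in\mathbb{C}^n$; as usual, critical points are taken among smooth points with all coordinates nonzero. *)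

theory Defs
  imports "HOL-Analysis.Analysis" "HOL-Library.Function_Algebras"
begin

section \<open>Affine varieties in complex coordinate space\<close>

text \<open>
  For a finite index set \<open>I\<close>, a point of \<open>\<complex>\<^sup>I\<close> is a function that vanishes outside \<open>I\<close>. This makes
  \<open>\<complex>\<^sup>I\<close> a linear subspace of the function space, so that tangent vectors live in the same set.
\<close>

definition coord_space :: "'i set \<Rightarrow> ('i \<Rightarrow> complex) set" where
  "coord_space I = {x. \<forall>i. i \<notin> I \<longrightarrow> x i = 0}"

text \<open>The ring \<open>\<complex>[x\<^sub>i | i \<in> I]\<close>, as polynomial functions on \<open>\<complex>\<^sup>I\<close>.\<close>

inductive_set poly_funs :: "'i set \<Rightarrow> (('i \<Rightarrow> complex) \<Rightarrow> complex) set" for I where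
  const: "(\<lambda>x. c) \<in> poly_funs I"
| coord: "i \<in> I \<Longrightarrow> (\<lambda>x. x i) \<in> poly_funs I"
| add: "f \<in> poly_funs I \<Longrightarrow> g \<in> poly_funs I \<Longrightarrow> (\<lambda>x. f x + g x) \<in> poly_funs I"
| mult: "f \<in> poly_funs I \<Longrightarrow> g \<in> poly_funs I \<Longrightarrow> (\<lambda>x. f x * g x) \<in> poly_funs I"

definition vanishing_ideal ::
  "'i set \<Rightarrow> ('i \<Rightarrow> complex) set \<Rightarrow> (('i \<Rightarrow> complex) \<Rightarrow> complex) set" where
  "vanishing_ideal I A = {f \<in> poly_funs I. \<forall>a\<in>A. f a = 0}"

definition zariski_closure :: "'i set \<Rightarrow> ('i \<Rightarrow> complex) set \<Rightarrow> ('i \<Rightarrow> complex) set" where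
  "zariski_closure I A = {x \<in> coord_space I. \<forall>f\<in>vanishing_ideal I A. f x = 0}"

definition partial_deriv ::
  "'i \<Rightarrow> (('i \<Rightarrow> complex) \<Rightarrow> complex) \<Rightarrow> ('i \<Rightarrow> complex) \<Rightarrow> complex" where
  "partial_deriv i f x = deriv (\<lambda>t. f (x(i := t))) (x i)"

definition tangent_space ::
  "'i set \<Rightarrow> ('i \<Rightarrow> complex) set \<Rightarrow> ('i \<Rightarrow> complex) \<Rightarrow> ('i \<Rightarrow> complex) set" where
  "tangent_space I X p =
     {v \<in> coord_space I. \<forall>f\<in>vanishing_ideal I X. (\<Sum>i\<in>I. partial_deriv i f p * v i) = 0}"

definition complex_dim :: "('i \<Rightarrow> complex) set \<Rightarrow> nat" where
  "complex_dim = vector_space.dim (\<lambda>c v i. c * v i)"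

text \<open>
  Smoothness by the Jacobian criterion: \<open>p\<close> is singular iff the rank of the Jacobian matrix of
  generators of the ideal of \<open>X\<close> drops at \<open>p\<close>. The rank at \<open>q\<close> is \<open>card I\<close> minus the dimension of the
  tangent space at \<open>q\<close>, and it is compared with the rank at the points of \<open>X\<close> in a Zariski
  neighbourhood \<open>{q \<in> X. g q \<noteq> 0}\<close> of \<open>p\<close>. A locally constant rank says that the cotangent sheaf of
  the (reduced) variety \<open>X\<close> is locally free at \<open>p\<close>, or that the dimension of the tangent space
  at \<open>p\<close> is the local dimension of \<open>X\<close> at \<open>p\<close>. For irreducible \<open>X\<close> the rank at \<open>p\<close> is then the
  maximal rank on \<open>X\<close>; the local form also covers reducible \<open>X\<close>.
\<close>

definition smooth_point :: "'i set \<Rightarrow> ('i \<Rightarrow> complex) set \<Rightarrow> ('i \<Rightarrow> complex) \<Rightarrow> bool" where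
  "smooth_point I X p \<longleftrightarrow> p \<in> X \<and>
     (\<exists>g\<in>poly_funs I. g p \<noteq> 0 \<and>
        (\<forall>q\<in>X. g q \<noteq> 0 \<longrightarrow>
           complex_dim (tangent_space I X q) = complex_dim (tangent_space I X p)))"


section \<open>Models, mixtures and the maximum likelihood degree\<close>

definition open_simplex :: "'i set \<Rightarrow> ('i \<Rightarrow> real) set" where
  "open_simplex I = {p. (\<forall>i\<in>I. 0 < p i) \<and> (\<forall>i. i \<notin> I \<longrightarrow> p i = 0) \<and> (\<Sum>i\<in>I. p i) = 1}"

definition Mixt :: "nat \<Rightarrow> ('i \<Rightarrow> real) set \<Rightarrow> ('i \<Rightarrow> real) set" where
  "Mixt r M =
     {(\<lambda>i. \<Sum>h\<in>{1..r}. w h * p h i) | w p. w \<in> open_simplex {1..r} \<and> (\<forall>h\<in>{1..r}. p h \<in> M)}"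

definition model_variety :: "'i set \<Rightarrow> ('i \<Rightarrow> real) set \<Rightarrow> ('i \<Rightarrow> complex) set" where
  "model_variety I M = zariski_closure I ((\<lambda>p i. complex_of_real (p i)) ` M)"

text \<open>
  The logarithm is multivalued on the complex torus, but the gradient of \<open>\<Sum>\<^sub>i u\<^sub>i log p\<^sub>i\<close> is the
  well-defined vector \<open>(u\<^sub>i / p\<^sub>i)\<^sub>i\<close>; criticality means that it annihilates the tangent space.
\<close>

definition critical_points ::
  "'i set \<Rightarrow> ('i \<Rightarrow> complex) set \<Rightarrow> ('i \<Rightarrow> complex) \<Rightarrow> ('i \<Rightarrow> complex) set" where
  "critical_points I X u =
     {p. smooth_point I X p \<and> (\<forall>i\<in>I. p i \<noteq> 0) \<and>
         (\<forall>v\<in>tangent_space I X p. (\<Sum>i\<in>I. u i / p i * v i) = 0)}"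

text \<open>Generic data: all \<open>u\<close> in some nonempty Zariski open subset \<open>{u. g u \<noteq> 0}\<close> of \<open>\<complex>\<^sup>I\<close>.\<close>

definition generic_critical_count :: "'i set \<Rightarrow> ('i \<Rightarrow> real) set \<Rightarrow> nat \<Rightarrow> bool" where
  "generic_critical_count I M N \<longleftrightarrow>
     (\<exists>g\<in>poly_funs I. (\<exists>u\<in>coord_space I. g u \<noteq> 0) \<and>
        (\<forall>u\<in>coord_space I. g u \<noteq> 0 \<longrightarrow>
           finite (critical_points I (model_variety I M) u) \<and>
           card (critical_points I (model_variety I M) u) = N))"

text \<open>
  It is a standard fact that the generic number exists for every model; the value \<open>0\<close> in the other
  branch is only there to make the function total.
\<close>

definition MLdeg :: "'i set \<Rightarrow> ('i \<Rightarrow> real) set \<Rightarrow> nat" where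
  "MLdeg I M =
     (if \<exists>N. generic_critical_count I M N then THE N. generic_critical_count I M N else 0)"


section \<open>Graphical models and clique stars\<close>

definition simple_graph :: "'v set \<Rightarrow> 'v set set \<Rightarrow> bool" where
  "simple_graph V E \<longleftrightarrow> finite V \<and> (\<forall>e\<in>E. e \<subseteq> V \<and> card e = 2)"

definition clique :: "'v set \<Rightarrow> 'v set set \<Rightarrow> 'v set \<Rightarrow> bool" where
  "clique V E A \<longleftrightarrow> A \<subseteq> V \<and> (\<forall>a\<in>A. \<forall>b\<in>A. a \<noteq> b \<longrightarrow> {a, b} \<in> E)"

definition maximal_cliques :: "'v set \<Rightarrow> 'v set set \<Rightarrow> 'v set set" where
  "maximal_cliques V E = {A. clique V E A \<and> (\<forall>B. clique V E B \<and> A \<subseteq> B \<longrightarrow> B = A)}"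

text \<open>
  \<open>D\<close> enumerates the maximal cliques (the cliques with a tilde) without repetition, as
  \<open>D 1, \<dots>, D k\<close>.
\<close>

definition clique_star ::
  "'v set \<Rightarrow> 'v set set \<Rightarrow> nat \<Rightarrow> (nat \<Rightarrow> 'v set) \<Rightarrow> 'v set \<Rightarrow> bool" where
  "clique_star V E k D S \<longleftrightarrow>
     bij_betw D {1..k} (maximal_cliques V E) \<and>
     V = (\<Union>i\<in>{1..k}. D i) \<and> E = (\<Union>i\<in>{1..k}. {e. e \<subseteq> D i \<and> card e = 2}) \<and>
     clique V E S \<and>
     (\<forall>i\<in>{1..k}. \<forall>j\<in>{1..k}. i \<noteq> j \<longrightarrow> D i \<inter> D j = S)"

definition states :: "('v \<Rightarrow> nat) \<Rightarrow> 'v set \<Rightarrow> ('v \<Rightarrow> nat) set" where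
  "states d A = (\<Pi>\<^sub>E v\<in>A. {1..d v})"

definition num_states :: "('v \<Rightarrow> nat) \<Rightarrow> 'v set \<Rightarrow> nat" where
  "num_states d A = (\<Prod>v\<in>A. d v)"

text \<open>Only the parameters \<open>\<theta> C j\<close> with \<open>C\<close> a maximal clique and \<open>j \<in> states d C\<close> are used.\<close>

definition monomial_map ::
  "'v set \<Rightarrow> 'v set set \<Rightarrow> ('v set \<Rightarrow> ('v \<Rightarrow> nat) \<Rightarrow> complex) \<Rightarrow> ('v \<Rightarrow> nat) \<Rightarrow> complex" where
  "monomial_map V E \<theta> i = (\<Prod>C\<in>maximal_cliques V E. \<theta> C (restrict i C))"

definition graphical_model ::
  "'v set \<Rightarrow> 'v set set \<Rightarrow> ('v \<Rightarrow> nat) \<Rightarrow> (('v \<Rightarrow> nat) \<Rightarrow> real) set" where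
  "graphical_model V E d =
     {p \<in> open_simplex (states d V).
        \<exists>\<theta>. \<forall>i\<in>states d V. complex_of_real (p i) = monomial_map V E \<theta> i}"

text \<open>
  The tensors of format \<open>n 1 \<times> \<dots> \<times> n k\<close> are indexed by \<open>states n {1..k}\<close>. A tensor in the open
  simplex is nonzero, so it has rank one iff it is an outer product of \<open>k\<close> vectors.
\<close>

definition independence_model :: "nat \<Rightarrow> (nat \<Rightarrow> nat) \<Rightarrow> ((nat \<Rightarrow> nat) \<Rightarrow> real) set" where
  "independence_model k n =
     {p \<in> open_simplex (states n {1..k}).
        \<exists>a :: nat \<Rightarrow> nat \<Rightarrow> real. \<forall>i\<in>states n {1..k}. p i = (\<Prod>j\<in>{1..k}. a j (i j))}"

end

theory Submission
  imports Defs "HOL-Computational_Algebra.Polynomial"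
begin

text \<open>
  Conditioning on the state \<open>t\<close> of the vertices in \<open>S\<close> separates the sets \<open>C\<^sub>1, \<dots>, C\<^sub>k\<close>. Hence the joint
  distributions in the graphical model are the families \<open>p\<^sub>t\<^sub>j = v\<^sub>t q\<^sup>t\<^sub>j\<close> with an arbitrary positive distribution
  \<open>v\<close> of \<open>t\<close> and, for each of the \<open>d\<^sub>S\<close> values of \<open>t\<close>, an arbitrary point \<open>q\<^sup>t\<close> of the independence model:
  \<open>graphical_eq_glue\<close>. Call this the result of gluing copies of the independence model. By Bayes' rule, gluing
  commutes with taking mixtures (\<open>Mixt_glue\<close>), so the theorem is the case
  \<open>N = Mixt r (independence_model k n)\<close> of \<open>MLdeg_glue\<close>: for every model \<open>N\<close>, gluing one copy for each element
  of \<open>T\<close> raises the maximum likelihood degree to the power \<open>card T\<close>.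

  To see this, let \<open>Y\<close> and \<open>X\<close> be the varieties of \<open>N\<close> and of the glued model. Where all block masses
  \<open>p\<^sub>t\<^sub>+ = \<Sum>\<^sub>j p\<^sub>t\<^sub>j\<close> are nonzero, \<open>X\<close> is the product of the weight space \<open>{v | \<Sum>\<^sub>t v\<^sub>t = 1}\<close> (with nonzero
  \<open>v\<^sub>t\<close>) and of copies of \<open>Y\<close>: \<open>(v, q) \<mapsto> (v\<^sub>t q\<^sup>t\<^sub>j)\<close> has the inverse \<open>v\<^sub>t = p\<^sub>t\<^sub>+\<close>, \<open>q\<^sup>t = p\<^sub>t / p\<^sub>t\<^sub>+\<close>
  (\<open>join_in_X\<close>, \<open>X_elim_join\<close>). Accordingly tangent spaces are direct sums (\<open>tangent_space_join\<close>), a point is smooth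
  iff its components are (\<open>smooth_join_slot\<close>, \<open>smooth_joinI\<close>), and the log-likelihood splits as
  \<open>\<Sum>\<^sub>t u\<^sub>t\<^sub>+ log v\<^sub>t + \<Sum>\<^sub>t \<Sum>\<^sub>j u\<^sub>t\<^sub>j log q\<^sup>t\<^sub>j\<close>. The first sum has the single critical point \<open>v\<^sub>t = u\<^sub>t\<^sub>+ / u\<^sub>+\<^sub>+\<close>, so critical
  points for \<open>u\<close> are tuples of critical points of \<open>Y\<close> for the data \<open>u\<^sub>t\<close> (\<open>critical_points_bij\<close>).

  Two points need an argument of their own. First, \<open>X\<close> may contain points with \<open>p\<^sub>t\<^sub>+ = 0\<close>, to which the product
  structure does not extend. These are handled by the vector field whose value at \<open>p\<close> is block
  \<open>t\<close> of \<open>p\<close>, extended by \<open>0\<close>, minus \<open>p\<^sub>t\<^sub>+ p\<close>. It is tangent to \<open>X\<close> everywhere (\<open>euler_field_tangent\<close>),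
  and criticality in its direction says \<open>u\<^sub>t\<^sub>+ = p\<^sub>t\<^sub>+ u\<^sub>+\<^sub>+\<close>, so such points are not critical for data
  with \<open>u\<^sub>t\<^sub>+ \<noteq> 0\<close>. Second, instead of proving that the number of critical points is generically constant,
  it suffices to transfer generic counts from \<open>N\<close> to the glued model
  (\<open>generic_critical_count_glue\<close>) and nonzero ones back (\<open>generic_critical_count_factor\<close>).
\<close>

section \<open>Polynomial functions\<close>

lemma poly_funs_cong:
  assumes "f \<in> poly_funs I" and "\<And>i. i \<in> I \<Longrightarrow> x i = y i"
  shows "f x = f y"
  using assms by (induction rule: poly_funs.induct) auto

lemma poly_funs_sum:
  assumes "\<And>a. a \<in> A \<Longrightarrow> f a \<in> poly_funs I"
  shows "(\<lambda>x. \<Sum>a\<in>A. f a x) \<in> poly_funs I"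
  using assms by (induction A rule: infinite_finite_induct) (auto intro: poly_funs.intros)

lemma poly_funs_prod:
  assumes "\<And>a. a \<in> A \<Longrightarrow> f a \<in> poly_funs I"
  shows "(\<lambda>x. \<Prod>a\<in>A. f a x) \<in> poly_funs I"
  using assms by (induction A rule: infinite_finite_induct) (auto intro: poly_funs.intros)

lemma poly_funs_power:
  assumes "f \<in> poly_funs I"
  shows "(\<lambda>x. f x ^ n) \<in> poly_funs I"
  using assms by (induction n) (auto intro: poly_funs.intros)

lemma poly_funs_diff:
  assumes "f \<in> poly_funs I" "g \<in> poly_funs I"
  shows "(\<lambda>x. f x - g x) \<in> poly_funs I"
proof -
  have "(\<lambda>x. f x + (\<lambda>x. -1) x * g x) \<in> poly_funs I"
    by (intro poly_funs.intros assms)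
  then show ?thesis by simp
qed

lemma poly_funs_compose:
  assumes "f \<in> poly_funs I" and "\<And>i. i \<in> I \<Longrightarrow> (\<lambda>x. \<phi> x i) \<in> poly_funs K"
  shows "(\<lambda>x. f (\<phi> x)) \<in> poly_funs K"
  using assms by (induction rule: poly_funs.induct) (auto intro: poly_funs.intros)

lemma poly_funs_differentiable_coord:
  assumes "f \<in> poly_funs I"
  shows "(\<lambda>t. f (x(i := t))) field_differentiable at z"
  using assms
proof (induction rule: poly_funs.induct)
  case (coord j)
  then show ?case
    by (cases "j = i") auto
qed (auto intro: derivative_intros)

lemma partial_deriv_add:
  assumes "f \<in> poly_funs I" "g \<in> poly_funs I"
  shows "partial_deriv i (\<lambda>x. f x + g x) x = partial_deriv i f x + partial_deriv i g x"
  unfolding partial_deriv_def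
  by (rule deriv_add) (auto intro: poly_funs_differentiable_coord assms)

lemma partial_deriv_mult:
  assumes "f \<in> poly_funs I" "g \<in> poly_funs I"
  shows "partial_deriv i (\<lambda>x. f x * g x) x = f x * partial_deriv i g x + partial_deriv i f x * g x"
  unfolding partial_deriv_def
  by (subst deriv_mult) (auto intro: poly_funs_differentiable_coord assms)

lemma partial_deriv_const: "partial_deriv i (\<lambda>x. c) x = 0"
  by (simp add: partial_deriv_def)

lemma partial_deriv_coord: "partial_deriv i (\<lambda>x. x j) x = (if i = j then 1 else 0)"
  by (simp add: partial_deriv_def)

lemma partial_deriv_poly_funs:
  assumes "f \<in> poly_funs I"
  shows "partial_deriv i f \<in> poly_funs I"
  using assms
proof (induction rule: poly_funs.induct)
  case (const c)
  have "partial_deriv i (\<lambda>x. c) = (\<lambda>x. 0)" by (simp add: fun_eq_iff partial_deriv_const)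
  then show ?case by (simp add: poly_funs.const)
next
  case (coord j)
  have "partial_deriv i (\<lambda>x. x j) = (\<lambda>x. if i = j then 1 else 0)"
    by (simp add: fun_eq_iff partial_deriv_coord)
  then show ?case by (simp add: poly_funs.const)
next
  case (add f g)
  then have "partial_deriv i (\<lambda>x. f x + g x) = (\<lambda>x. partial_deriv i f x + partial_deriv i g x)"
    by (intro ext partial_deriv_add)
  then show ?case using add by (simp add: poly_funs.add)
next
  case (mult f g)
  then have "partial_deriv i (\<lambda>x. f x * g x) =
      (\<lambda>x. f x * partial_deriv i g x + partial_deriv i f x * g x)"
    by (intro ext partial_deriv_mult)
  then show ?case using mult by (simp add: poly_funs.add poly_funs.mult)
qed

text \<open>Tangency is tested by differentiating along curves, by the chain rule.\<close>

lemma poly_funs_chain_rule: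
  assumes f: "f \<in> poly_funs I" and I: "finite I"
    and \<gamma>: "\<And>i. i \<in> I \<Longrightarrow> ((\<lambda>s. \<gamma> s i) has_field_derivative w i) (at s0)"
  shows "((\<lambda>s. f (\<gamma> s)) has_field_derivative (\<Sum>i\<in>I. partial_deriv i f (\<gamma> s0) * w i)) (at s0)"
  using f
proof (induction rule: poly_funs.induct)
  case (const c)
  show ?case by (simp add: partial_deriv_const)
next
  case (coord j)
  have "(\<Sum>i\<in>I. partial_deriv i (\<lambda>x. x j) (\<gamma> s0) * w i) = w j"
    using coord I by (simp add: partial_deriv_coord if_distrib[of "\<lambda>c. c * _"] cong: if_cong)
  then show ?case using \<gamma>[OF coord] by simp
next
  case (add f g)
  then show ?case
    using DERIV_add[OF add.IH]
    by (simp add: partial_deriv_add[OF add.hyps] distrib_right sum.distrib)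
next
  case (mult f g)
  show ?case
    using DERIV_mult'[OF mult.IH]
    by (simp add: partial_deriv_mult[OF mult.hyps] distrib_left sum.distrib
        sum_distrib_left sum_distrib_right mult_ac)
qed

text \<open>
  Restricting to lines reduces density questions to the finiteness of the roots of a univariate polynomial.
\<close>

lemma poly_funs_on_line:
  assumes "f \<in> poly_funs I"
  obtains P :: "complex poly" where "\<And>s. f (\<lambda>i. a i + s * b i) = poly P s"
proof -
  have "\<exists>P. \<forall>s. f (\<lambda>i. a i + s * b i) = poly P s"
    using assms
  proof (induction rule: poly_funs.induct)
    case (const c)
    show ?case by (rule exI[of _ "[:c:]"]) simp
  next
    case (coord i)
    show ?case by (rule exI[of _ "[:a i, b i:]"]) simp
  next
    case (add f g)
    then obtain P Q where "\<forall>s. f (\<lambda>i. a i + s * b i) = poly P s"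
      "\<forall>s. g (\<lambda>i. a i + s * b i) = poly Q s" by blast
    then show ?case by (intro exI[of _ "P + Q"]) simp
  next
    case (mult f g)
    then obtain P Q where "\<forall>s. f (\<lambda>i. a i + s * b i) = poly P s"
      "\<forall>s. g (\<lambda>i. a i + s * b i) = poly Q s" by blast
    then show ?case by (intro exI[of _ "P * Q"]) simp
  qed
  then show ?thesis using that by blast
qed

text \<open>
  \<open>\<complex>[x\<^sub>i | i \<in> I]\<close> is an integral domain: restrict both factors to the line through a point where
  the first one is nonzero and a point where the second one is.
\<close>

lemma poly_funs_mult_nonzero:
  assumes f: "f \<in> poly_funs I" and g: "g \<in> poly_funs I"
    and a: "a \<in> coord_space I" "f a \<noteq> 0" and b: "b \<in> coord_space I" "g b \<noteq> 0"
  obtains c where "c \<in> coord_space I" "f c \<noteq> 0" "g c \<noteq> 0"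
proof -
  obtain P where P: "\<And>s. f (\<lambda>i. a i + s * (b i - a i)) = poly P s"
    using poly_funs_on_line[OF f] by metis
  obtain Q where Q: "\<And>s. g (\<lambda>i. a i + s * (b i - a i)) = poly Q s"
    using poly_funs_on_line[OF g] by metis
  have "P \<noteq> 0" using P[of 0] a by auto
  moreover have "Q \<noteq> 0" using Q[of 1] b by auto
  ultimately have "P * Q \<noteq> 0" by simp
  then obtain s where "poly (P * Q) s \<noteq> 0"
    using poly_all_0_iff_0[of "P * Q"] by blast
  then have "poly P s \<noteq> 0" "poly Q s \<noteq> 0" by auto
  then show ?thesis
    using a b P Q by (intro that[of "\<lambda>i. a i + s * (b i - a i)"]) (auto simp: coord_space_def)
qed

text \<open>
  Homogenisation: a power of \<open>\<sigma>\<close> clears the denominators of \<open>f (\<phi> x / \<sigma> x)\<close>. It turns equations for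
  conditional distributions into polynomial equations for joint ones.
\<close>

lemma poly_funs_clear_denominator:
  assumes f: "f \<in> poly_funs J" and \<sigma>: "\<sigma> \<in> poly_funs I"
    and \<phi>: "\<And>j. j \<in> J \<Longrightarrow> (\<lambda>x. \<phi> x j) \<in> poly_funs I"
  obtains F e where "F \<in> poly_funs I" "\<And>x. \<sigma> x \<noteq> 0 \<Longrightarrow> F x = \<sigma> x ^ e * f (\<lambda>j. \<phi> x j / \<sigma> x)"
proof -
  have "\<exists>F\<in>poly_funs I. \<exists>e. \<forall>x. \<sigma> x \<noteq> 0 \<longrightarrow> F x = \<sigma> x ^ e * f (\<lambda>j. \<phi> x j / \<sigma> x)"
    using f
  proof (induction rule: poly_funs.induct)
    case (const c)
    show ?case by (rule bexI[of _ "\<lambda>x. c"], rule exI[of _ 0]) (auto intro: poly_funs.intros)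
  next
    case (coord j)
    show ?case
      by (rule bexI[of _ "\<lambda>x. \<phi> x j"], rule exI[of _ 1]) (auto intro: \<phi> coord)
  next
    case (add f g)
    then obtain F e G e' where F: "F \<in> poly_funs I"
      "\<forall>x. \<sigma> x \<noteq> 0 \<longrightarrow> F x = \<sigma> x ^ e * f (\<lambda>j. \<phi> x j / \<sigma> x)"
      and G: "G \<in> poly_funs I" "\<forall>x. \<sigma> x \<noteq> 0 \<longrightarrow> G x = \<sigma> x ^ e' * g (\<lambda>j. \<phi> x j / \<sigma> x)"
      by blast
    show ?case
      by (rule bexI[of _ "\<lambda>x. \<sigma> x ^ e' * F x + \<sigma> x ^ e * G x"], rule exI[of _ "e + e'"])
        (auto simp: F(2) G(2) power_add algebra_simps
          intro!: poly_funs.add poly_funs.mult poly_funs_power F(1) G(1) \<sigma>)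
  next
    case (mult f g)
    then obtain F e G e' where F: "F \<in> poly_funs I"
      "\<forall>x. \<sigma> x \<noteq> 0 \<longrightarrow> F x = \<sigma> x ^ e * f (\<lambda>j. \<phi> x j / \<sigma> x)"
      and G: "G \<in> poly_funs I" "\<forall>x. \<sigma> x \<noteq> 0 \<longrightarrow> G x = \<sigma> x ^ e' * g (\<lambda>j. \<phi> x j / \<sigma> x)"
      by blast
    show ?case
      by (rule bexI[of _ "\<lambda>x. F x * G x"], rule exI[of _ "e + e'"])
        (auto simp: F(2) G(2) power_add algebra_simps
          intro!: poly_funs.add poly_funs.mult poly_funs_power F(1) G(1) \<sigma>)
  qed
  then show ?thesis using that by blast
qed

section \<open>Zariski closures\<close>

lemma zariski_closure_superset:
  assumes "A \<subseteq> coord_space I"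
  shows "A \<subseteq> zariski_closure I A"
  using assms by (auto simp: zariski_closure_def vanishing_ideal_def)

lemma vanishing_ideal_zariski_closure:
  assumes "A \<subseteq> coord_space I"
  shows "vanishing_ideal I (zariski_closure I A) = vanishing_ideal I A"
  using zariski_closure_superset[OF assms]
  by (auto simp: zariski_closure_def vanishing_ideal_def)

lemma poly_vanishing_near_0:
  fixes P :: "complex poly"
  assumes "0 < \<epsilon>" and "\<And>s::real. \<bar>s\<bar> < \<epsilon> \<Longrightarrow> poly P (of_real s) = 0"
  shows "poly P z = 0"
proof -
  have "infinite {0<..<\<epsilon>}" using assms(1) by simp
  then have "infinite (complex_of_real ` {0<..<\<epsilon>})"
    by (subst finite_image_iff) (auto simp: inj_on_def)
  moreover have "complex_of_real ` {0<..<\<epsilon>} \<subseteq> {x. poly P x = 0}" using assms(2) by auto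
  ultimately have "infinite {x. poly P x = 0}" using finite_subset by blast
  then have "P = 0" using poly_roots_finite[of P] by blast
  then show ?thesis by simp
qed

text \<open>
  The simplex is Zariski dense in the complex affine hyperplane that it spans. A point
  \<open>x + \<i> y\<close> of the hyperplane is reached from the barycentre \<open>c\<close> along \<open>c + s (x - c) + s' y\<close>: for small
  real \<open>s\<close> and \<open>s'\<close> these points lie in the simplex, so the polynomial identity extends first to
  \<open>s = 1\<close> and then to \<open>s' = \<i>\<close>.
\<close>

lemma vanishing_on_simplex:
  assumes f: "f \<in> poly_funs T" and T: "finite T" "T \<noteq> {}"
    and van: "\<And>v. v \<in> open_simplex T \<Longrightarrow> f (\<lambda>t. of_real (v t)) = 0"
    and w: "(\<Sum>t\<in>T. w t) = 1"
  shows "f w = 0"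
proof -
  define c where "c = (1 / real (card T))"
  have card: "0 < card T" using T by (simp add: card_gt_0_iff)
  then have c: "0 < c" by (simp add: c_def)
  \<comment> \<open>For real \<open>s\<close> and \<open>s'\<close> of absolute value below \<open>c / K\<close> all coordinates stay positive.\<close>
  define K where "K = (\<Sum>t\<in>T. \<bar>Re (w t) - c\<bar> + \<bar>Im (w t)\<bar>) + 1"
  have K: "0 < K" unfolding K_def by (simp add: sum_nonneg add_nonneg_pos)
  have bound: "\<bar>Re (w t) - c\<bar> + \<bar>Im (w t)\<bar> < K" if "t \<in> T" for t
    using member_le_sum[OF that, of "\<lambda>t. \<bar>Re (w t) - c\<bar> + \<bar>Im (w t)\<bar>"] T
    by (auto simp: K_def)
  have sums: "(\<Sum>t\<in>T. Re (w t)) = 1" "(\<Sum>t\<in>T. Im (w t)) = 0"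
    using w by (simp_all flip: Re_sum Im_sum)
  define g where "g s s' = f (\<lambda>t. of_real c + s * of_real (Re (w t) - c) + s' * of_real (Im (w t)))"
    for s s'
  have small: "g (of_real s) (of_real s') = 0" if s: "\<bar>s\<bar> < c / K" "\<bar>s'\<bar> < c / K" for s s' :: real
  proof -
    define v where "v t = (if t \<in> T then c + s * (Re (w t) - c) + s' * Im (w t) else 0)" for t
    have "v \<in> open_simplex T"
      unfolding open_simplex_def
    proof (intro CollectI conjI ballI allI impI)
      fix t assume t: "t \<in> T"
      have "\<bar>s * (Re (w t) - c)\<bar> + \<bar>s' * Im (w t)\<bar> \<le> c / K * \<bar>Re (w t) - c\<bar> + c / K * \<bar>Im (w t)\<bar>"
        using s unfolding abs_mult by (intro add_mono mult_right_mono) auto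
      also have "\<dots> = c / K * (\<bar>Re (w t) - c\<bar> + \<bar>Im (w t)\<bar>)" by (simp add: algebra_simps)
      also have "\<dots> < c / K * K" using bound[OF t] c K by (intro mult_strict_left_mono) auto
      also have "\<dots> = c" using K by simp
      finally show "0 < v t" using t by (simp add: v_def)
    next
      have "(\<Sum>t\<in>T. v t) = (\<Sum>t\<in>T. c) + s * ((\<Sum>t\<in>T. Re (w t)) - (\<Sum>t\<in>T. c)) + s' * (\<Sum>t\<in>T. Im (w t))"
        by (simp add: v_def sum.distrib sum_subtractf algebra_simps flip: sum_distrib_left)
      also have "(\<Sum>t\<in>T. c) = 1" using card by (simp add: c_def)
      finally show "sum v T = 1" by (simp add: sums)
    qed (simp add: v_def)
    from van[OF this] show ?thesis
      unfolding g_def using f by (subst poly_funs_cong[OF f]) (auto simp: v_def)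
  qed
  have "g s (of_real s') = 0" if s': "\<bar>s'\<bar> < c / K" for s and s' :: real
  proof -
    obtain P where P: "\<And>s. f (\<lambda>t. (of_real c + of_real s' * of_real (Im (w t)))
        + s * of_real (Re (w t) - c)) = poly P s"
      using poly_funs_on_line[OF f, of "\<lambda>t. of_real c + of_real s' * of_real (Im (w t))"
          "\<lambda>t. of_real (Re (w t) - c)"] by metis
    have *: "g s (of_real s') = poly P s" for s
      by (simp add: g_def P[symmetric] add_ac)
    show ?thesis unfolding *
    proof (rule poly_vanishing_near_0)
      show "0 < c / K" using c K by simp
      show "poly P (of_real s) = 0" if "\<bar>s\<bar> < c / K" for s :: real
        using small[OF that s'] * by simp
    qed
  qed
  note real_s' = this
  obtain P where P: "\<And>s'. f (\<lambda>t. of_real (Re (w t)) + s' * of_real (Im (w t))) = poly P s'"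
    using poly_funs_on_line[OF f, of "\<lambda>t. of_real (Re (w t))" "\<lambda>t. of_real (Im (w t))"] by metis
  have g1: "g 1 s' = poly P s'" for s'
    by (simp add: g_def P[symmetric])
  have "poly P \<i> = 0"
  proof (rule poly_vanishing_near_0)
    show "0 < c / K" using c K by simp
    show "poly P (of_real s) = 0" if "\<bar>s\<bar> < c / K" for s :: real
      using real_s'[OF that, of 1] g1 by simp
  qed
  then show ?thesis
    by (simp add: P[symmetric] flip: complex_eq)
qed

section \<open>Dimensions of subspaces of coordinate space\<close>

interpretation cfun: vector_space "\<lambda>(c::complex) (v::'i \<Rightarrow> complex) i. c * v i"
  by unfold_locales (auto simp: fun_eq_iff algebra_simps)

interpretation cfun_pair: vector_space_pair
  "\<lambda>(c::complex) (v::'i \<Rightarrow> complex) i. c * v i" "\<lambda>(c::complex) (v::'j \<Rightarrow> complex) i. c * v i"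
  by unfold_locales

lemma subspace_tangent_space: "cfun.subspace (tangent_space I X p)"
  by (auto simp: cfun.subspace_def tangent_space_def coord_space_def distrib_left sum.distrib
      mult.left_commute simp flip: sum_distrib_left)

text \<open>
  The ambient function space may have infinite dimension, so finiteness of bases has to come from the
  finitely many unit vectors that span \<open>\<complex>\<^sup>I\<close>.
\<close>

lemma finite_independent_in_coord_space:
  assumes "finite I" "B \<subseteq> coord_space I" "cfun.independent B"
  shows "finite B"
proof -
  define ind where "ind i = (\<lambda>j. if j = i then 1 else (0::complex))" for i :: 'a
  have "coord_space I \<subseteq> cfun.span (ind ` I)"
  proof
    fix x assume x: "x \<in> coord_space I"
    have *: "(\<Sum>i\<in>A. (\<lambda>j. x i * ind i j)) j = (\<Sum>i\<in>A. x i * ind i j)" for A j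
      by (induction A rule: infinite_finite_induct) auto
    have "x = (\<Sum>i\<in>I. (\<lambda>j. x i * ind i j))"
    proof
      fix j
      show "x j = (\<Sum>i\<in>I. (\<lambda>j. x i * ind i j)) j"
        unfolding * using x assms(1)
        by (cases "j \<in> I") (auto simp: ind_def coord_space_def if_distrib[of "\<lambda>c. _ * c"] cong: if_cong)
    qed
    also have "\<dots> \<in> cfun.span (ind ` I)"
      by (intro cfun.span_sum cfun.span_scale cfun.span_base) auto
    finally show "x \<in> cfun.span (ind ` I)" .
  qed
  then show ?thesis
    using cfun.independent_span_bound[of "ind ` I" B] assms by auto
qed

lemma complex_dim_0: "complex_dim {0 :: 'i \<Rightarrow> complex} = 0"
  unfolding complex_dim_def
  using cfun.dim_eq_card_independent[of "{} :: ('i \<Rightarrow> complex) set"]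
    cfun.dim_span[of "{} :: ('i \<Rightarrow> complex) set"]
  by (simp only: cfun.independent_empty cfun.span_empty card.empty not_False_eq_True True_implies_equals)

lemma subspace_linear_image:
  fixes f :: "('i \<Rightarrow> complex) \<Rightarrow> ('j \<Rightarrow> complex)"
  assumes V: "cfun.subspace V"
    and add: "\<And>x y. f (x + y) = f x + f y" and scale: "\<And>c x. f (\<lambda>i. c * x i) = (\<lambda>j. c * f x j)"
  shows "cfun.subspace (f ` V)"
proof -
  have lin: "Vector_Spaces.linear (\<lambda>c v i. c * v i) (\<lambda>c v i. c * v i) f"
    by unfold_locales (auto simp: add scale)
  show ?thesis by (rule cfun_pair.linear_subspace_image[OF lin V])
qed

lemma complex_dim_injective_image:
  fixes f :: "('i \<Rightarrow> complex) \<Rightarrow> ('j \<Rightarrow> complex)"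
  assumes V: "cfun.subspace V" and inj: "inj_on f V"
    and add: "\<And>x y. f (x + y) = f x + f y" and scale: "\<And>c x. f (\<lambda>i. c * x i) = (\<lambda>j. c * f x j)"
  shows "complex_dim (f ` V) = complex_dim V"
proof -
  obtain B where B: "B \<subseteq> V" "cfun.independent B" "V \<subseteq> cfun.span B" "card B = cfun.dim V"
    using cfun.basis_exists[of V] by blast
  have span: "cfun.span B = V" using B V cfun.span_minimal by blast
  have lin: "Vector_Spaces.linear (\<lambda>c v i. c * v i) (\<lambda>c v i. c * v i) f"
    by unfold_locales (auto simp: add scale)
  have "cfun.independent (f ` B)"
    using cfun_pair.linear_independent_injective_image[OF lin B(2)] inj span by simp
  moreover have "f ` V = cfun.span (f ` B)"
    using cfun_pair.linear_span_image[OF lin, of B] span by simp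
  moreover have "card (f ` B) = card B"
    using inj B(1) by (intro card_image) (rule inj_on_subset)
  ultimately show ?thesis
    unfolding complex_dim_def using B(4) by (simp add: cfun.dim_eq_card_independent)
qed

lemma complex_dim_direct_sum:
  fixes U W :: "('i \<Rightarrow> complex) set"
  assumes U: "cfun.subspace U" "U \<subseteq> coord_space I" and W: "cfun.subspace W" "W \<subseteq> coord_space I"
    and I: "finite I" and int: "U \<inter> W \<subseteq> {0}"
  shows "complex_dim {x + y | x y. x \<in> U \<and> y \<in> W} = complex_dim U + complex_dim W"
proof -
  obtain A where A: "A \<subseteq> U" "cfun.independent A" "U \<subseteq> cfun.span A" "card A = cfun.dim U"
    using cfun.basis_exists[of U] by blast
  obtain B where B: "B \<subseteq> W" "cfun.independent B" "W \<subseteq> cfun.span B" "card B = cfun.dim W"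
    using cfun.basis_exists[of W] by blast
  have sA: "cfun.span A = U" using A U cfun.span_minimal by blast
  have sB: "cfun.span B = W" using B W cfun.span_minimal by blast
  have fin: "finite A" "finite B"
    using finite_independent_in_coord_space[OF I] A B U W by blast+
  have B0: "0 \<notin> B" using B(2) cfun.dependent_zero by blast
  \<comment> \<open>Add the vectors of \<open>B\<close> one by one; a dependency would give a nonzero common vector of \<open>U\<close> and \<open>W\<close>.\<close>
  have "cfun.independent (A \<union> B')" if "B' \<subseteq> B" for B'
    using finite_subset[OF that fin(2)] that
  proof (induction B')
    case empty
    then show ?case using A(2) by simp
  next
    case (insert b B')
    have "b \<notin> cfun.span (A \<union> B')"
    proof
      assume "b \<in> cfun.span (A \<union> B')"
      then obtain x y where xy: "x \<in> U" "y \<in> cfun.span B'" "b = x + y"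
        by (auto simp: cfun.span_Un sA)
      have yW: "y \<in> W" using xy(2) cfun.span_mono[of B' B] insert.prems sB by auto
      have "x = b - y" using xy(3) by simp
      then have "x \<in> W" using cfun.subspace_diff[OF W(1)] B(1) insert.prems yW by auto
      then have "x = 0" using int xy(1) by auto
      then have "b \<in> cfun.span B'" using xy by simp
      moreover have "cfun.independent (insert b B')"
        using cfun.independent_mono[OF B(2) insert.prems] .
      ultimately show False using insert.hyps(2) by (simp add: cfun.independent_insert)
    qed
    then show ?case
      using insert by (simp add: cfun.independent_insertI)
  qed
  then have "cfun.independent (A \<union> B)" by blast
  moreover have "cfun.span (A \<union> B) = {x + y | x y. x \<in> U \<and> y \<in> W}"
    by (simp add: cfun.span_Un sA sB)
  moreover have "A \<inter> B = {}" using A(1) B(1) int B0 by blast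
  ultimately show ?thesis
    using fin A(4) B(4) cfun.dim_span_eq_card_independent[of "A \<union> B"]
    by (simp add: complex_dim_def card_Un_disjoint)
qed

section \<open>Curves and tangent vectors\<close>

lemma partial_deriv_sum_along_vanishing_curve:
  assumes "f \<in> poly_funs I" "finite I" "\<And>s. f (\<gamma> s) = 0"
    and "\<And>i. i \<in> I \<Longrightarrow> ((\<lambda>s. \<gamma> s i) has_field_derivative w i) (at s0)"
  shows "(\<Sum>i\<in>I. partial_deriv i f (\<gamma> s0) * w i) = 0"
  proof -
  have "((\<lambda>s. f (\<gamma> s)) has_field_derivative (\<Sum>i\<in>I. partial_deriv i f (\<gamma> s0) * w i)) (at s0)"
    by (rule poly_funs_chain_rule[OF assms(1,2)]) (rule assms(4))
  then show ?thesis using assms(3) by (simp add: DERIV_unique)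
qed

lemma deriv_along_tangent_curve:
  assumes "w \<in> tangent_space I X (\<gamma> s0)" "f \<in> vanishing_ideal I X" "finite I"
    and "\<And>i. i \<in> I \<Longrightarrow> ((\<lambda>s. \<gamma> s i) has_field_derivative w i) (at s0)"
  shows "((\<lambda>s. f (\<gamma> s)) has_field_derivative 0) (at s0)"
proof -
  have "f \<in> poly_funs I" using assms(2) by (simp add: vanishing_ideal_def)
  then have "((\<lambda>s. f (\<gamma> s)) has_field_derivative (\<Sum>i\<in>I. partial_deriv i f (\<gamma> s0) * w i)) (at s0)"
    using assms(3) by (rule poly_funs_chain_rule) (rule assms(4))
  then show ?thesis using assms(1,2) by (simp add: tangent_space_def)
qed

lemma line_has_field_derivative:
  "((\<lambda>s. x + s * y) has_field_derivative y) (at (s0::complex))"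
  by (auto intro!: derivative_eq_intros)

section \<open>Varieties of models in the simplex\<close>

lemma complexified_simplex_subset: "(\<lambda>p i. complex_of_real (p i)) ` open_simplex I \<subseteq> coord_space I"
  by (auto simp: open_simplex_def coord_space_def)

lemma vanishing_ideal_model_variety:
  assumes "M \<subseteq> open_simplex I"
  shows "f \<in> vanishing_ideal I (model_variety I M) \<longleftrightarrow>
    f \<in> poly_funs I \<and> (\<forall>p\<in>M. f (\<lambda>i. of_real (p i)) = 0)"
proof -
  have "(\<lambda>p i. complex_of_real (p i)) ` M \<subseteq> coord_space I"
    using assms complexified_simplex_subset by blast
  from vanishing_ideal_zariski_closure[OF this] show ?thesis
    unfolding model_variety_def by (auto simp: vanishing_ideal_def)
qed

lemma model_variety_iff:
  assumes "M \<subseteq> open_simplex I"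
  shows "p \<in> model_variety I M \<longleftrightarrow>
    p \<in> coord_space I \<and> (\<forall>f\<in>vanishing_ideal I (model_variety I M). f p = 0)"
  using vanishing_ideal_model_variety[OF assms]
  by (auto simp: model_variety_def zariski_closure_def vanishing_ideal_def)

lemma vanishing_idealD: "f \<in> vanishing_ideal I X \<Longrightarrow> p \<in> X \<Longrightarrow> f p = 0"
  by (simp add: vanishing_ideal_def)

lemma total_in_vanishing_ideal:
  assumes "M \<subseteq> open_simplex I"
  shows "(\<lambda>x. (\<Sum>i\<in>I. x i) - 1) \<in> vanishing_ideal I (model_variety I M)"
  unfolding vanishing_ideal_model_variety[OF assms] using assms
  by (auto intro!: poly_funs_diff poly_funs_sum poly_funs.intros simp: open_simplex_def
      simp flip: of_real_sum)

lemma model_variety_total: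
  assumes "M \<subseteq> open_simplex I" "p \<in> model_variety I M"
  shows "(\<Sum>i\<in>I. p i) = 1"
  using assms total_in_vanishing_ideal[OF assms(1)] by (auto simp: model_variety_iff[OF assms(1)])

lemma tangent_space_total:
  assumes M: "M \<subseteq> open_simplex I" and I: "finite I"
    and w: "w \<in> tangent_space I (model_variety I M) p"
  shows "(\<Sum>i\<in>I. w i) = 0"
proof -
  define \<gamma> where "\<gamma> = (\<lambda>s i. p i + s * w i)"
  have w0: "w \<in> tangent_space I (model_variety I M) (\<gamma> 0)"
    using w by (simp add: \<gamma>_def)
  have "((\<lambda>s. (\<Sum>i\<in>I. \<gamma> s i) - 1) has_field_derivative 0) (at 0)"
    by (rule deriv_along_tangent_curve[where \<gamma> = \<gamma> and ?s0.0 = 0, OF w0 total_in_vanishing_ideal[OF M] I])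
      (simp add: \<gamma>_def line_has_field_derivative)
  moreover have "((\<lambda>s. (\<Sum>i\<in>I. \<gamma> s i) - 1) has_field_derivative (\<Sum>i\<in>I. w i) - 0) (at 0)"
    by (intro DERIV_diff DERIV_sum) (auto simp: \<gamma>_def line_has_field_derivative)
  ultimately show ?thesis using DERIV_unique by fastforce
qed

section \<open>Gluing copies of a model\<close>

text \<open>
  The index set \<open>I\<close> is split into blocks, one for each \<open>t \<in> T\<close>; position \<open>\<rho> i\<close> in block \<open>\<tau> i\<close>
  identifies \<open>i\<close>.
\<close>

locale block_index =
  fixes I :: "'i set" and T :: "'t set" and J :: "'j set"
    and \<tau> :: "'i \<Rightarrow> 't" and \<rho> :: "'i \<Rightarrow> 'j"
  assumes finite_T: "finite T" and T_nonempty: "T \<noteq> {}"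
    and finite_J: "finite J" and J_nonempty: "J \<noteq> {}"
    and bij: "bij_betw (\<lambda>i. (\<tau> i, \<rho> i)) I (T \<times> J)"
begin

definition assemble :: "('t \<Rightarrow> 'j \<Rightarrow> 'a::zero) \<Rightarrow> 'i \<Rightarrow> 'a" where
  "assemble x = (\<lambda>i. if i \<in> I then x (\<tau> i) (\<rho> i) else 0)"

definition block :: "'t \<Rightarrow> ('i \<Rightarrow> 'a::zero) \<Rightarrow> 'j \<Rightarrow> 'a" where
  "block t p = (\<lambda>j. if j \<in> J then p (inv_into I (\<lambda>i. (\<tau> i, \<rho> i)) (t, j)) else 0)"

definition mass :: "'t \<Rightarrow> ('i \<Rightarrow> 'a::comm_monoid_add) \<Rightarrow> 'a" where
  "mass t p = (\<Sum>j\<in>J. block t p j)"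

lemma finite_I: "finite I"
  using bij_betw_finite[OF bij] finite_T finite_J by simp

lemma \<tau>_in: "i \<in> I \<Longrightarrow> \<tau> i \<in> T" and \<rho>_in: "i \<in> I \<Longrightarrow> \<rho> i \<in> J"
  using bij_betw_apply[OF bij] by auto

lemma block_eq: "i \<in> I \<Longrightarrow> block (\<tau> i) p (\<rho> i) = p i"
  using inv_into_f_f[OF bij_betw_imp_inj_on[OF bij], of i] \<rho>_in by (simp add: block_def)

lemma assemble_block: "(\<And>i. i \<notin> I \<Longrightarrow> p i = 0) \<Longrightarrow> assemble (\<lambda>t. block t p) = p"
  by (auto simp: assemble_def block_eq fun_eq_iff)

lemma block_index_at:
  assumes "t \<in> T" "j \<in> J"
  shows "inv_into I (\<lambda>i. (\<tau> i, \<rho> i)) (t, j) \<in> I"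
    and "\<tau> (inv_into I (\<lambda>i. (\<tau> i, \<rho> i)) (t, j)) = t"
    and "\<rho> (inv_into I (\<lambda>i. (\<tau> i, \<rho> i)) (t, j)) = j"
proof -
  have "(t, j) \<in> (\<lambda>i. (\<tau> i, \<rho> i)) ` I" using bij assms by (auto simp: bij_betw_def)
  from f_inv_into_f[OF this] inv_into_into[OF this] show
    "inv_into I (\<lambda>i. (\<tau> i, \<rho> i)) (t, j) \<in> I"
    "\<tau> (inv_into I (\<lambda>i. (\<tau> i, \<rho> i)) (t, j)) = t"
    "\<rho> (inv_into I (\<lambda>i. (\<tau> i, \<rho> i)) (t, j)) = j"
    by auto
qed

lemma block_assemble: "t \<in> T \<Longrightarrow> j \<in> J \<Longrightarrow> block t (assemble x) j = x t j"
  by (simp add: block_def assemble_def block_index_at)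

lemma block_assemble_fun:
  "t \<in> T \<Longrightarrow> x t \<in> coord_space J \<Longrightarrow> block t (assemble x) = x t"
  by (rule ext, rename_tac j, case_tac "j \<in> J")
    (simp_all add: block_assemble, simp_all add: block_def coord_space_def)

lemma mass_assemble: "t \<in> T \<Longrightarrow> mass t (assemble x) = (\<Sum>j\<in>J. x t j)"
  by (simp add: mass_def block_assemble)

lemma assemble_cong:
  "(\<And>t j. t \<in> T \<Longrightarrow> j \<in> J \<Longrightarrow> x t j = y t j) \<Longrightarrow> assemble x = assemble y"
  by (auto simp: assemble_def fun_eq_iff \<tau>_in \<rho>_in)

lemma sum_blocks: "(\<Sum>i\<in>I. F (\<tau> i) (\<rho> i)) = (\<Sum>t\<in>T. \<Sum>j\<in>J. F t j)"
  using sum.reindex_bij_betw[OF bij, of "\<lambda>(t, j). F t j"]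
  by (simp add: sum.cartesian_product)

lemma sum_mass: "(\<Sum>i\<in>I. p i) = (\<Sum>t\<in>T. mass t p)"
proof -
  have "(\<Sum>i\<in>I. p i) = (\<Sum>i\<in>I. block (\<tau> i) p (\<rho> i))" by (simp add: block_eq)
  then show ?thesis using sum_blocks[of "\<lambda>t. block t p"] by (simp add: mass_def)
qed

lemma assemble_in_coord_space: "assemble x \<in> coord_space I"
  by (simp add: assemble_def coord_space_def)

lemma block_in_coord_space: "block t p \<in> coord_space J"
  by (simp add: block_def coord_space_def)

lemma block_line: "block t (\<lambda>i. p i + s * w i) j = block t p j + s * block t w j"
  for p w :: "'i \<Rightarrow> complex"
  by (simp add: block_def)

lemma mass_line: "mass t (\<lambda>i. p i + s * w i) = mass t p + s * mass t w"
  for p w :: "'i \<Rightarrow> complex"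
  by (simp add: mass_def block_line sum.distrib sum_distrib_left)

lemma block_poly: "t \<in> T \<Longrightarrow> (\<lambda>p. block t p j) \<in> poly_funs I"
  by (cases "j \<in> J") (auto simp: block_def intro!: poly_funs.intros block_index_at)

lemma mass_poly: "t \<in> T \<Longrightarrow> (\<lambda>p. mass t p) \<in> poly_funs I"
  unfolding mass_def by (intro poly_funs_sum block_poly)

lemma assemble_poly:
  assumes "\<And>t j. t \<in> T \<Longrightarrow> j \<in> J \<Longrightarrow> (\<lambda>x. F x t j) \<in> poly_funs K"
  shows "(\<lambda>x. assemble (F x) i) \<in> poly_funs K"
  using assms \<tau>_in \<rho>_in by (cases "i \<in> I") (auto simp: assemble_def intro: poly_funs.const)

definition glue :: "('j \<Rightarrow> real) set \<Rightarrow> ('i \<Rightarrow> real) set" where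
  "glue N = {assemble (\<lambda>t j. v t * q t j) | v q. v \<in> open_simplex T \<and> (\<forall>t\<in>T. q t \<in> N)}"

text \<open>
  The parametrisation of a glued model: weights \<open>v\<^sub>t\<close> for the blocks and a point \<open>q\<^sup>t\<close> for each block.
  It is also used with weights \<open>a\<close> of sum \<open>0\<close>, as the derivative of the parametrisation in the direction
  of the weights.
\<close>

definition join :: "('t \<Rightarrow> complex) \<Rightarrow> ('t \<Rightarrow> 'j \<Rightarrow> complex) \<Rightarrow> 'i \<Rightarrow> complex" where
  "join v q = assemble (\<lambda>t j. v t * q t j)"

lemma glue_subset_simplex:
  assumes "N \<subseteq> open_simplex J"
  shows "glue N \<subseteq> open_simplex I"
proof
  fix p assume "p \<in> glue N"
  then obtain v q where p: "p = assemble (\<lambda>t j. v t * q t j)" and v: "v \<in> open_simplex T"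
    and q: "\<forall>t\<in>T. q t \<in> open_simplex J"
    using assms by (auto simp: glue_def)
  have "sum p I = (\<Sum>t\<in>T. v t * (\<Sum>j\<in>J. q t j))"
    by (simp add: sum_mass p mass_assemble sum_distrib_left)
  also have "\<dots> = 1" using v q by (simp add: open_simplex_def)
  finally show "p \<in> open_simplex I"
    using v q by (auto simp: open_simplex_def p assemble_def \<tau>_in \<rho>_in)
qed

lemma complexified_glue:
  "(\<lambda>i. complex_of_real (assemble (\<lambda>t j. v t * q t j) i)) =
    join (\<lambda>t. of_real (v t)) (\<lambda>t j. of_real (q t j))"
  by (auto simp: join_def assemble_def)

lemma join_in_coord_space: "join v q \<in> coord_space I"
  by (simp add: join_def assemble_in_coord_space)

lemma mass_join: "t \<in> T \<Longrightarrow> (\<Sum>j\<in>J. q t j) = 1 \<Longrightarrow> mass t (join v q) = v t"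
  by (simp add: join_def mass_assemble flip: sum_distrib_left)

lemma block_join: "t \<in> T \<Longrightarrow> j \<in> J \<Longrightarrow> block t (join v q) j = v t * q t j"
  by (simp add: join_def block_assemble)

end

locale glued_model = block_index I T J \<tau> \<rho>
  for I :: "'i set" and T :: "'t set" and J :: "'j set"
    and \<tau> :: "'i \<Rightarrow> 't" and \<rho> :: "'i \<Rightarrow> 'j" +
  fixes N :: "('j \<Rightarrow> real) set"
  assumes N_simplex: "N \<subseteq> open_simplex J"
begin

abbreviation Y :: "('j \<Rightarrow> complex) set" where "Y \<equiv> model_variety J N"
abbreviation X :: "('i \<Rightarrow> complex) set" where "X \<equiv> model_variety I (glue N)"

lemmas vanishing_Y = vanishing_ideal_model_variety[OF N_simplex]
lemmas vanishing_X = vanishing_ideal_model_variety[OF glue_subset_simplex[OF N_simplex]]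
lemmas Y_iff = model_variety_iff[OF N_simplex]
lemmas X_iff = model_variety_iff[OF glue_subset_simplex[OF N_simplex]]
lemmas Y_total = model_variety_total[OF N_simplex]
lemmas X_total = model_variety_total[OF glue_subset_simplex[OF N_simplex]]

lemma Y_coord: "q \<in> Y \<Longrightarrow> q \<in> coord_space J"
  by (simp add: Y_iff)

lemma X_coord: "p \<in> X \<Longrightarrow> p \<in> coord_space I"
  by (simp add: X_iff)

lemma vanishing_X_iff:
  "f \<in> vanishing_ideal I X \<longleftrightarrow> f \<in> poly_funs I \<and>
    (\<forall>v q. v \<in> open_simplex T \<longrightarrow> (\<forall>t\<in>T. q t \<in> N) \<longrightarrow>
      f (join (\<lambda>t. of_real (v t)) (\<lambda>t j. of_real (q t j))) = 0)"
proof -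
  have "(\<forall>p\<in>glue N. f (\<lambda>i. of_real (p i)) = 0) \<longleftrightarrow>
    (\<forall>v q. v \<in> open_simplex T \<longrightarrow> (\<forall>t\<in>T. q t \<in> N) \<longrightarrow>
      f (\<lambda>i. complex_of_real (assemble (\<lambda>t j. v t * q t j) i)) = 0)"
    unfolding glue_def by blast
  then show ?thesis unfolding vanishing_X complexified_glue by blast
qed

lemma join_poly_weights:
  assumes "f \<in> poly_funs I"
  shows "(\<lambda>v. f (join v q)) \<in> poly_funs T"
  unfolding join_def
  by (intro poly_funs_compose[OF assms] assemble_poly poly_funs.intros)

lemma join_poly_slot:
  assumes "f \<in> poly_funs I"
  shows "(\<lambda>x. f (join v (q(t := x)))) \<in> poly_funs J"
proof -
  have *: "(\<lambda>x. (q(t := x)) t' j) \<in> poly_funs J" if "j \<in> J" for t' j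
    using that by (cases "t' = t") (auto intro: poly_funs.intros)
  show ?thesis
    unfolding join_def
    by (intro poly_funs_compose[OF assms] assemble_poly poly_funs.mult poly_funs.const *)
qed

text \<open>
  The parametrisation extends to the closures, one argument at a time: for points of \<open>N\<close> the weights may
  become complex because the simplex is dense in its hyperplane, and then each \<open>q\<^sup>t\<close> in turn may leave \<open>N\<close>,
  because as a function of \<open>q\<^sup>t\<close> alone every equation of \<open>X\<close> is an equation of \<open>Y\<close>.
\<close>

lemma join_in_X:
  assumes v: "(\<Sum>t\<in>T. v t) = 1" and q: "\<And>t. t \<in> T \<Longrightarrow> q t \<in> Y"
  shows "join v q \<in> X"
  unfolding X_iff
proof (intro conjI ballI join_in_coord_space)
  fix f assume f: "f \<in> vanishing_ideal I X"
  then have fp: "f \<in> poly_funs I" by (simp add: vanishing_X)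
  have "f (join v q) = 0"
    if "finite F" "F \<subseteq> T" "\<forall>t\<in>F. q t \<in> Y"
      "\<forall>t\<in>T - F. q t \<in> (\<lambda>p i. complex_of_real (p i)) ` N" for F and q
    using that
  proof (induction F arbitrary: q)
    case empty
    then have "\<forall>t. \<exists>r. t \<in> T \<longrightarrow> r \<in> N \<and> q t = (\<lambda>i. complex_of_real (r i))"
      by auto
    then obtain r where r: "\<And>t. t \<in> T \<Longrightarrow> r t \<in> N \<and> q t = (\<lambda>i. complex_of_real (r t i))"
      by metis
    show ?case
    proof (rule vanishing_on_simplex[OF join_poly_weights[OF fp] finite_T T_nonempty _ v])
      fix v assume v: "v \<in> open_simplex T"
      have "join (\<lambda>t. of_real (v t)) q = join (\<lambda>t. of_real (v t)) (\<lambda>t j. of_real (r t j))"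
        unfolding join_def by (rule assemble_cong) (simp add: r)
      moreover have "f (join (\<lambda>t. of_real (v t)) (\<lambda>t j. of_real (r t j))) = 0"
        using f v r unfolding vanishing_X_iff by blast
      ultimately show "f (join (\<lambda>t. of_real (v t)) q) = 0" by simp
    qed
  next
    case (insert t F)
    have "(\<lambda>x. f (join v (q(t := x)))) \<in> vanishing_ideal J Y"
      unfolding vanishing_Y
    proof (intro conjI ballI join_poly_slot[OF fp])
      show "f (join v (q(t := \<lambda>i. complex_of_real (p i)))) = 0" if "p \<in> N" for p
        using insert.prems insert.hyps that by (intro insert.IH) auto
    qed
    moreover have "q t \<in> Y" using insert.prems(2) by simp
    ultimately have "f (join v (q(t := q t))) = 0"
      by (rule vanishing_idealD)
    then show ?case by simp
  qed
  from this[OF finite_T] show "f (join v q) = 0"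
    using q by simp
qed

text \<open>
  Conditioning on a block of nonzero mass maps \<open>X\<close> to \<open>Y\<close>, because equations of \<open>Y\<close> pull back to equations
  of \<open>X\<close> after homogenisation.
\<close>

lemma pull_back_equation:
  assumes t: "t \<in> T" and g: "g \<in> vanishing_ideal J Y"
  obtains F e where "F \<in> vanishing_ideal I X"
    "\<And>x. mass t x \<noteq> 0 \<Longrightarrow> F x = mass t x ^ e * g (\<lambda>j. block t x j / mass t x)"
proof -
  have gp: "g \<in> poly_funs J" using g by (simp add: vanishing_Y)
  obtain F e where F: "F \<in> poly_funs I"
    "\<And>x. mass t x \<noteq> 0 \<Longrightarrow> F x = mass t x ^ e * g (\<lambda>j. block t x j / mass t x)"
    using poly_funs_clear_denominator[where \<sigma> = "mass t" and \<phi> = "block t",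
        OF gp mass_poly[OF t] block_poly[OF t]] by metis
  have "F (join (\<lambda>t. of_real (v t)) (\<lambda>t j. of_real (q t j))) = 0" (is "F ?p = 0")
    if v: "v \<in> open_simplex T" and q: "\<forall>t\<in>T. q t \<in> N" for v q
  proof -
    have "q t \<in> open_simplex J" using q t N_simplex by auto
    then have m: "mass t ?p = of_real (v t)"
      using t by (subst mass_join) (auto simp: open_simplex_def simp flip: of_real_sum)
    have "v t \<noteq> 0" using v t by (auto simp: open_simplex_def)
    moreover have "g (\<lambda>j. block t ?p j / mass t ?p) = g (\<lambda>j. of_real (q t j))"
      using \<open>v t \<noteq> 0\<close> by (intro poly_funs_cong[OF gp]) (simp add: m block_join t)
    moreover have "g (\<lambda>j. of_real (q t j)) = 0" using g q t unfolding vanishing_Y by blast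
    ultimately show ?thesis using F(2)[of ?p] m by simp
  qed
  then have "F \<in> vanishing_ideal I X" unfolding vanishing_X_iff using F(1) by blast
  then show ?thesis using that F(2) by blast
qed

text \<open>
  Where no block has mass \<open>0\<close>, the parametrisation is onto; its inverse is conditioning on the blocks.
\<close>

lemma X_elim_join:
  assumes p: "p \<in> X" and mass: "\<And>t. t \<in> T \<Longrightarrow> mass t p \<noteq> 0"
  obtains q where "\<And>t. t \<in> T \<Longrightarrow> q t \<in> Y" "p = join (\<lambda>t. mass t p) q"
proof
  show "(\<lambda>j. block t p j / mass t p) \<in> Y" if t: "t \<in> T" for t
    unfolding Y_iff
  proof (intro conjI ballI)
    show "(\<lambda>j. block t p j / mass t p) \<in> coord_space J"
      using block_in_coord_space[of t p] by (simp add: coord_space_def)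
    fix g assume g: "g \<in> vanishing_ideal J Y"
    obtain F e where F: "F \<in> vanishing_ideal I X"
      "\<And>x. mass t x \<noteq> 0 \<Longrightarrow> F x = mass t x ^ e * g (\<lambda>j. block t x j / mass t x)"
      using pull_back_equation[OF t g] by metis
    have "F p = 0" using F(1) p by (rule vanishing_idealD)
    then show "g (\<lambda>j. block t p j / mass t p) = 0"
      using F(2)[OF mass[OF t]] mass[OF t] by simp
  qed
  have "assemble (\<lambda>t. block t p) = p"
    using X_coord[OF p] by (intro assemble_block) (simp add: coord_space_def)
  moreover have "join (\<lambda>t. mass t p) (\<lambda>t j. block t p j / mass t p) = assemble (\<lambda>t. block t p)"
    unfolding join_def by (rule assemble_cong) (simp add: mass)
  ultimately show "p = join (\<lambda>t. mass t p) (\<lambda>t j. block t p j / mass t p)" by simp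
qed


section \<open>Tangent spaces, smooth points and critical points of a glued model\<close>

lemma tangent_X_total: "w \<in> tangent_space I X p \<Longrightarrow> (\<Sum>t\<in>T. mass t w) = 0"
  using tangent_space_total[OF glue_subset_simplex[OF N_simplex] finite_I] by (simp add: sum_mass)

lemma tangent_Y_total: "b \<in> tangent_space J Y q \<Longrightarrow> (\<Sum>j\<in>J. b j) = 0"
  by (rule tangent_space_total[OF N_simplex finite_J])

text \<open>
  The tangent space of \<open>X\<close> is the image of the derivative of the parametrisation. The next two lemmas
  show that this image is tangent, by differentiating equations of \<open>X\<close> along curves \<open>v + s a\<close> of weights
  and along a move of a single \<open>q\<^sup>t\<close>.
\<close>

lemma tangent_weights:
  assumes v: "(\<Sum>t\<in>T. v t) = 1" and q: "\<And>t. t \<in> T \<Longrightarrow> q t \<in> Y" and a: "(\<Sum>t\<in>T. a t) = 0"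
  shows "join a q \<in> tangent_space I X (join v q)"
  unfolding tangent_space_def
proof (intro CollectI conjI ballI join_in_coord_space)
  fix f assume f: "f \<in> vanishing_ideal I X"
  then have fp: "f \<in> poly_funs I" by (simp add: vanishing_X)
  define \<gamma> where "\<gamma> = (\<lambda>s. join (\<lambda>t. v t + s * a t) q)"
  have "(\<Sum>i\<in>I. partial_deriv i f (\<gamma> 0) * join a q i) = 0"
  proof (rule partial_deriv_sum_along_vanishing_curve[OF fp finite_I])
    fix s
    have "(\<Sum>t\<in>T. v t + s * a t) = 1"
      using v a by (simp add: sum.distrib flip: sum_distrib_left)
    then have "\<gamma> s \<in> X" unfolding \<gamma>_def using q by (rule join_in_X)
    with f show "f (\<gamma> s) = 0" by (rule vanishing_idealD)
  next
    fix i assume "i \<in> I"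
    have *: "(\<lambda>s. \<gamma> s i) = (\<lambda>s. v (\<tau> i) * q (\<tau> i) (\<rho> i) + s * join a q i)"
      using \<open>i \<in> I\<close> by (auto simp: \<gamma>_def join_def assemble_def algebra_simps)
    show "((\<lambda>s. \<gamma> s i) has_field_derivative join a q i) (at 0)"
      unfolding * by (rule line_has_field_derivative)
  qed
  then show "(\<Sum>i\<in>I. partial_deriv i f (join v q) * join a q i) = 0"
    by (simp add: \<gamma>_def)
qed

lemma tangent_slot:
  assumes v: "(\<Sum>t\<in>T. v t) = 1" and q: "\<And>t. t \<in> T \<Longrightarrow> q t \<in> Y"
    and t: "t \<in> T" and b: "b \<in> tangent_space J Y (q t)"
  shows "assemble ((\<lambda>_ _. 0)(t := \<lambda>j. v t * b j)) \<in> tangent_space I X (join v q)"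
    (is "?w \<in> _")
  unfolding tangent_space_def
proof (intro CollectI conjI ballI assemble_in_coord_space)
  fix f assume f: "f \<in> vanishing_ideal I X"
  then have fp: "f \<in> poly_funs I" by (simp add: vanishing_X)
  define h where "h = (\<lambda>x. f (join v (q(t := x))))"
  define \<gamma> where "\<gamma> = (\<lambda>s j. q t j + s * b j)"
  have h: "h \<in> vanishing_ideal J Y"
    unfolding vanishing_ideal_def
  proof (intro CollectI conjI ballI)
    show "h \<in> poly_funs J" unfolding h_def by (rule join_poly_slot[OF fp])
    fix x assume "x \<in> Y"
    then have "join v (q(t := x)) \<in> X" using q by (intro join_in_X[OF v]) auto
    with f show "h x = 0" unfolding h_def by (rule vanishing_idealD)
  qed
  have "((\<lambda>s. h (\<gamma> s)) has_field_derivative 0) (at 0)"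
  proof (rule deriv_along_tangent_curve[where \<gamma> = \<gamma>, OF _ h finite_J])
    show "b \<in> tangent_space J Y (\<gamma> 0)" using b by (simp add: \<gamma>_def)
    show "((\<lambda>s. \<gamma> s j) has_field_derivative b j) (at 0)" for j
      unfolding \<gamma>_def by (rule line_has_field_derivative)
  qed
  moreover have "((\<lambda>s. h (\<gamma> s)) has_field_derivative
      (\<Sum>i\<in>I. partial_deriv i f (join v (q(t := \<gamma> 0))) * ?w i)) (at 0)"
    unfolding h_def
  proof (rule poly_funs_chain_rule[OF fp finite_I])
    fix i assume "i \<in> I"
    then have *: "(\<lambda>s. join v (q(t := \<gamma> s)) i) = (\<lambda>s. v (\<tau> i) * q (\<tau> i) (\<rho> i) + s * ?w i)"
      by (auto simp: \<gamma>_def join_def assemble_def algebra_simps)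
    show "((\<lambda>s. join v (q(t := \<gamma> s)) i) has_field_derivative ?w i) (at 0)"
      unfolding * by (rule line_has_field_derivative)
  qed
  moreover have "q(t := \<gamma> 0) = q" by (simp add: \<gamma>_def)
  ultimately show "(\<Sum>i\<in>I. partial_deriv i f (join v q) * ?w i) = 0"
    using DERIV_unique by metis
qed

text \<open>
  Conversely, a tangent vector of \<open>X\<close> is mapped to one of \<open>Y\<close> by the derivative of conditioning: apply
  it to the homogenisation \<open>F\<close> of an equation \<open>g\<close> of \<open>Y\<close>. The power of the mass in front of \<open>g\<close>
  contributes nothing to the derivative, because \<open>g\<close> vanishes at the point \<open>q\<^sup>t\<close>.
\<close>

lemma tangent_project:
  assumes q: "\<And>t. t \<in> T \<Longrightarrow> q t \<in> Y" and t: "t \<in> T" and vt: "v t \<noteq> 0"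
    and w: "w \<in> tangent_space I X (join v q)"
  shows "(\<lambda>j. block t w j - mass t w * q t j) \<in> tangent_space J Y (q t)"
    (is "?b \<in> _")
  unfolding tangent_space_def
proof (intro CollectI conjI ballI)
  have qt: "q t \<in> Y" using q t by blast
  show "?b \<in> coord_space J"
    using Y_coord[OF qt] block_in_coord_space[of t w] by (simp add: coord_space_def)
  fix g assume g: "g \<in> vanishing_ideal J Y"
  then have gp: "g \<in> poly_funs J" by (simp add: vanishing_Y)
  obtain F e where F: "F \<in> vanishing_ideal I X"
    "\<And>x. mass t x \<noteq> 0 \<Longrightarrow> F x = mass t x ^ e * g (\<lambda>j. block t x j / mass t x)"
    using pull_back_equation[OF t g] by metis
  define p where "p = join v q"
  \<comment> \<open>The line \<open>\<gamma>\<close> leaves \<open>X\<close> in general; \<open>\<delta>\<close> is its image under conditioning on block \<open>t\<close>.\<close>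
  define \<gamma> where "\<gamma> = (\<lambda>s i. p i + s * w i)"
  define \<delta> where "\<delta> = (\<lambda>s j. (block t p j + s * block t w j) / (mass t p + s * mass t w))"
  have m: "mass t p = v t" unfolding p_def using t Y_total[OF qt] by (rule mass_join)
  have bl: "block t p j = v t * q t j" if "j \<in> J" for j
    unfolding p_def using t that by (rule block_join)
  have \<delta>0: "\<delta> 0 j = q t j" if "j \<in> J" for j
    using vt that by (simp add: \<delta>_def m bl)
  define D where "D = (\<Sum>j\<in>J. partial_deriv j g (\<delta> 0) * (?b j / v t))"
  have gd: "((\<lambda>s. g (\<delta> s)) has_field_derivative D) (at 0)"
    unfolding D_def
  proof (rule poly_funs_chain_rule[OF gp finite_J])
    fix j assume j: "j \<in> J"
    have "((\<lambda>s. (block t p j + s * block t w j) / (mass t p + s * mass t w)) has_field_derivative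
        (block t w j * (mass t p + 0 * mass t w) - (block t p j + 0 * block t w j) * mass t w)
          / ((mass t p + 0 * mass t w) * (mass t p + 0 * mass t w))) (at 0)"
      using vt by (intro DERIV_divide line_has_field_derivative) (simp add: m)
    moreover have "(block t w j * (mass t p + 0 * mass t w) - (block t p j + 0 * block t w j) * mass t w)
          / ((mass t p + 0 * mass t w) * (mass t p + 0 * mass t w)) = ?b j / v t"
      using vt by (simp add: m bl[OF j] field_simps)
    ultimately show "((\<lambda>s. \<delta> s j) has_field_derivative ?b j / v t) (at 0)"
      by (simp add: \<delta>_def)
  qed
  have "g (\<delta> 0) = g (q t)" by (rule poly_funs_cong[OF gp]) (rule \<delta>0)
  also have "\<dots> = 0" using g qt by (rule vanishing_idealD)
  finally have g0: "g (\<delta> 0) = 0" .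
  have md: "((\<lambda>s. (mass t p + s * mass t w) ^ e) has_field_derivative
      of_nat e * (mass t w * (mass t p + 0 * mass t w) ^ (e - 1))) (at 0)"
    using DERIV_power[OF line_has_field_derivative[of "mass t p" "mass t w" 0], of e] by simp
  have "((\<lambda>s. (mass t p + s * mass t w) ^ e * g (\<delta> s)) has_field_derivative v t ^ e * D) (at 0)"
    using DERIV_mult[OF md gd] by (simp add: g0 m mult.commute)
  moreover have "((\<lambda>s. (mass t p + s * mass t w) ^ e * g (\<delta> s)) has_field_derivative 0) (at 0)"
  proof (rule has_field_derivative_transform_within_open)
    show "((\<lambda>s. F (\<gamma> s)) has_field_derivative 0) (at 0)"
    proof (rule deriv_along_tangent_curve[where \<gamma> = \<gamma>, OF _ F(1) finite_I])
      show "w \<in> tangent_space I X (\<gamma> 0)" using w by (simp add: \<gamma>_def p_def)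
      show "((\<lambda>s. \<gamma> s i) has_field_derivative w i) (at 0)" for i
        unfolding \<gamma>_def by (rule line_has_field_derivative)
    qed
    show "open {s. mass t p + s * mass t w \<noteq> 0}"
      by (intro open_Collect_neq continuous_intros)
    show "0 \<in> {s. mass t p + s * mass t w \<noteq> 0}" using vt by (simp add: m)
    show "F (\<gamma> s) = (mass t p + s * mass t w) ^ e * g (\<delta> s)"
      if "s \<in> {s. mass t p + s * mass t w \<noteq> 0}" for s
      using F(2)[of "\<gamma> s"] that by (simp add: \<gamma>_def \<delta>_def mass_line block_line)
  qed
  ultimately have "v t ^ e * D = 0" by (rule DERIV_unique)
  then have "D = 0" using vt by simp
  moreover have "D = (\<Sum>j\<in>J. partial_deriv j g (q t) * ?b j) / v t"
  proof -
    have "partial_deriv j g (\<delta> 0) = partial_deriv j g (q t)" for j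
      by (rule poly_funs_cong[OF partial_deriv_poly_funs[OF gp]]) (rule \<delta>0)
    then show ?thesis by (simp add: D_def sum_divide_distrib)
  qed
  ultimately show "(\<Sum>j\<in>J. partial_deriv j g (q t) * ?b j) = 0" using vt by simp
qed

text \<open>
  The velocity of \<open>q\<^sup>t\<close> enters the derivative of the parametrisation with the factor \<open>v\<^sub>t\<close>, which is
  invertible and therefore absorbed in \<open>b\<^sup>t\<close>.
\<close>

lemma tangent_space_join:
  assumes v: "(\<Sum>t\<in>T. v t) = 1" and vnz: "\<And>t. t \<in> T \<Longrightarrow> v t \<noteq> 0"
    and q: "\<And>t. t \<in> T \<Longrightarrow> q t \<in> Y"
  shows "tangent_space I X (join v q) =
    {join a q + assemble b | a b. (\<Sum>t\<in>T. a t) = 0 \<and> (\<forall>t\<in>T. b t \<in> tangent_space J Y (q t))}"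
    (is "?L = ?R")
proof
  show "?L \<subseteq> ?R"
  proof
    fix w assume w: "w \<in> ?L"
    define b where "b = (\<lambda>t j. block t w j - mass t w * q t j)"
    have "b t \<in> tangent_space J Y (q t)" if "t \<in> T" for t
      using tangent_project[OF q that vnz[OF that] w] by (simp add: b_def)
    moreover have "w = join (\<lambda>t. mass t w) q + assemble b"
    proof -
      have "w = assemble (\<lambda>t. block t w)"
        using w by (intro assemble_block[symmetric]) (auto simp: tangent_space_def coord_space_def)
      also have "\<dots> = join (\<lambda>t. mass t w) q + assemble b"
        by (auto simp: join_def assemble_def b_def fun_eq_iff)
      finally show ?thesis .
    qed
    ultimately show "w \<in> ?R" using tangent_X_total[OF w] by blast
  qed
  show "?R \<subseteq> ?L"
  proof clarify
    fix a :: "'t \<Rightarrow> complex" and b assume a: "(\<Sum>t\<in>T. a t) = 0" and b: "\<forall>t\<in>T. b t \<in> tangent_space J Y (q t)"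
    have "assemble (\<lambda>t. if t \<in> F then b t else (\<lambda>_. 0)) \<in> ?L" if "F \<subseteq> T" "finite F" for F
      using that(2,1)
    proof (induction F)
      case empty
      have zero: "assemble (\<lambda>t. if t \<in> {} then b t else (\<lambda>_. 0)) = (0 :: 'i \<Rightarrow> complex)"
        by (simp add: assemble_def fun_eq_iff)
      show ?case unfolding zero by (rule cfun.subspace_0[OF subspace_tangent_space])
    next
      case (insert t F)
      let ?e = "assemble ((\<lambda>_ _. 0)(t := \<lambda>j. v t * b t j))"
      have "?e \<in> ?L" using insert.prems b by (intro tangent_slot[OF v q]) auto
      then have "(\<lambda>i. (1 / v t) * ?e i) \<in> ?L" by (rule cfun.subspace_scale[OF subspace_tangent_space])
      moreover have "assemble (\<lambda>t. if t \<in> F then b t else (\<lambda>_. 0)) \<in> ?L"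
        using insert by auto
      ultimately have "(\<lambda>i. (1 / v t) * ?e i) + assemble (\<lambda>t. if t \<in> F then b t else (\<lambda>_. 0)) \<in> ?L"
        by (rule cfun.subspace_add[OF subspace_tangent_space])
      also have "(\<lambda>i. (1 / v t) * ?e i) + assemble (\<lambda>t. if t \<in> F then b t else (\<lambda>_. 0)) =
          assemble (\<lambda>t'. if t' \<in> insert t F then b t' else (\<lambda>_. 0))"
        using insert.hyps insert.prems vnz[of t] by (auto simp: assemble_def fun_eq_iff)
      finally show ?case .
    qed
    from this[OF order_refl finite_T] have "assemble b \<in> ?L"
      using assemble_cong[of "\<lambda>t. if t \<in> T then b t else (\<lambda>_. 0)" b] by simp
    then show "join a q + assemble b \<in> ?L"
      using tangent_weights[OF v q a] by (intro cfun.subspace_add[OF subspace_tangent_space])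
  qed
qed


lemma subspace_assemble:
  assumes W: "\<And>t. t \<in> T \<Longrightarrow> cfun.subspace (W t)"
  shows "cfun.subspace {assemble b | b. \<forall>t\<in>T. b t \<in> W t}" (is "cfun.subspace ?S")
  unfolding cfun.subspace_def
proof (intro conjI ballI allI)
  have "(0 :: 'i \<Rightarrow> complex) = assemble (\<lambda>t. 0)" by (simp add: assemble_def fun_eq_iff)
  then show "0 \<in> ?S" using cfun.subspace_0[OF W] by blast
next
  fix x y assume "x \<in> ?S" "y \<in> ?S"
  then obtain b b' where b: "x = assemble b" "\<forall>t\<in>T. b t \<in> W t"
    and b': "y = assemble b'" "\<forall>t\<in>T. b' t \<in> W t" by blast
  have "x + y = assemble (\<lambda>t. b t + b' t)" by (simp add: b b' assemble_def fun_eq_iff)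
  moreover have "\<forall>t\<in>T. b t + b' t \<in> W t"
    using b(2) b'(2) by (auto intro: cfun.subspace_add[OF W])
  ultimately show "x + y \<in> ?S" by blast
next
  fix c x assume "x \<in> ?S"
  then obtain b where b: "x = assemble b" "\<forall>t\<in>T. b t \<in> W t" by blast
  have "(\<lambda>i. c * x i) = assemble (\<lambda>t j. c * b t j)" by (simp add: b assemble_def fun_eq_iff)
  moreover have "\<forall>t\<in>T. (\<lambda>j. c * b t j) \<in> W t"
    using b(2) by (auto intro: cfun.subspace_scale[OF W])
  ultimately show "(\<lambda>i. c * x i) \<in> ?S" by blast
qed

text \<open>
  Dimensions add up over the blocks. The induction is over the set \<open>F\<close> of blocks in which the vectors may
  be nonzero.
\<close>

lemma complex_dim_assemble:
  assumes W: "\<And>t. t \<in> T \<Longrightarrow> cfun.subspace (W t)" "\<And>t. t \<in> T \<Longrightarrow> W t \<subseteq> coord_space J"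
    and F: "F \<subseteq> T"
  shows "complex_dim {assemble b | b. \<forall>t\<in>T. b t \<in> (if t \<in> F then W t else {0})} =
    (\<Sum>t\<in>F. complex_dim (W t))" (is "complex_dim (?S F) = _")
proof -
  have fin: "finite F" using F finite_T finite_subset by blast
  have subspace: "cfun.subspace (?S F)" for F
  proof (rule subspace_assemble)
    fix t assume "t \<in> T"
    then show "cfun.subspace (if t \<in> F then W t else {0})"
      by (cases "t \<in> F") (simp_all only: if_True if_False W(1) cfun.subspace_single_0)
  qed
  have coord: "?S F \<subseteq> coord_space I" for F by (auto simp: assemble_in_coord_space)
  show ?thesis using fin F
  proof (induction F)
    case empty
    have "?S {} \<subseteq> {0}" by (auto simp: assemble_def fun_eq_iff \<tau>_in)
    moreover have "0 \<in> ?S {}" by (rule cfun.subspace_0[OF subspace])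
    ultimately have "?S {} = {0}" by (simp only: subset_singleton_iff) blast
    then show ?case by (simp only: complex_dim_0 sum.empty)
  next
    case (insert t F)
    then have t: "t \<in> T" by simp
    define \<epsilon> where "\<epsilon> = (\<lambda>b :: 'j \<Rightarrow> complex. assemble ((\<lambda>_. 0)(t := b)))"
    have \<epsilon>_add: "\<epsilon> (x + y) = \<epsilon> x + \<epsilon> y" for x y
      by (auto simp: \<epsilon>_def assemble_def fun_eq_iff)
    have \<epsilon>_scale: "\<epsilon> (\<lambda>i. c * x i) = (\<lambda>j. c * \<epsilon> x j)" for c x
      by (auto simp: \<epsilon>_def assemble_def fun_eq_iff)
    have block_\<epsilon>: "block t (\<epsilon> b) = b" if "b \<in> W t" for b
      unfolding \<epsilon>_def using that W(2)[OF t] t by (subst block_assemble_fun) auto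
    have "inj_on \<epsilon> (W t)" by (rule inj_on_inverseI[where g = "block t"]) (rule block_\<epsilon>)
    then have dim\<epsilon>: "complex_dim (\<epsilon> ` W t) = complex_dim (W t)"
      by (intro complex_dim_injective_image W(1)[OF t] \<epsilon>_add \<epsilon>_scale)
    have sub\<epsilon>: "cfun.subspace (\<epsilon> ` W t)"
      by (rule subspace_linear_image[OF W(1)[OF t] \<epsilon>_add \<epsilon>_scale])
    have coord\<epsilon>: "\<epsilon> ` W t \<subseteq> coord_space I" by (auto simp: \<epsilon>_def assemble_in_coord_space)
    have "?S (insert t F) = {x + y | x y. x \<in> \<epsilon> ` W t \<and> y \<in> ?S F}"
    proof (intro set_eqI iffI)
      fix w assume "w \<in> ?S (insert t F)"
      then obtain b where b: "w = assemble b" "\<forall>t'\<in>T. b t' \<in> (if t' \<in> insert t F then W t' else {0})"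
        by blast
      have "w = \<epsilon> (b t) + assemble (b(t := 0))"
        by (auto simp: b(1) \<epsilon>_def assemble_def fun_eq_iff)
      moreover have "\<epsilon> (b t) \<in> \<epsilon> ` W t" using b(2) t by auto
      moreover have "\<forall>t'\<in>T. (b(t := 0)) t' \<in> (if t' \<in> F then W t' else {0})"
        using b(2) insert.hyps by auto
      ultimately show "w \<in> {x + y | x y. x \<in> \<epsilon> ` W t \<and> y \<in> ?S F}" by blast
    next
      fix w assume "w \<in> {x + y | x y. x \<in> \<epsilon> ` W t \<and> y \<in> ?S F}"
      then obtain x y where xy: "w = x + y" "x \<in> \<epsilon> ` W t" "y \<in> ?S F" by blast
      obtain c where c: "x = \<epsilon> c" "c \<in> W t" using xy(2) by blast
      obtain b where b: "y = assemble b" "\<forall>t'\<in>T. b t' \<in> (if t' \<in> F then W t' else {0})"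
        using xy(3) by blast
      note cb = xy(1)[unfolded c(1) b(1)] c(2) b(2)
      have "b t = 0" using cb(3) insert.hyps t by auto
      then have "w = assemble (b(t := c))"
        by (auto simp: cb(1) \<epsilon>_def assemble_def fun_eq_iff)
      moreover have "\<forall>t'\<in>T. (b(t := c)) t' \<in> (if t' \<in> insert t F then W t' else {0})"
        using cb by auto
      ultimately show "w \<in> ?S (insert t F)" by blast
    qed
    moreover have "\<epsilon> ` W t \<inter> ?S F \<subseteq> {0}"
    proof
      fix x assume x: "x \<in> \<epsilon> ` W t \<inter> ?S F"
      obtain c where c: "x = \<epsilon> c" "c \<in> W t" using x by blast
      obtain b where b: "x = assemble b" "\<forall>t'\<in>T. b t' \<in> (if t' \<in> F then W t' else {0})"
        using x by blast
      have "b t = 0" using b(2) insert.hyps t by auto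
      then have "block t (assemble b) = 0"
        using t by (subst block_assemble_fun) (auto simp: coord_space_def)
      then have "c = 0" using block_\<epsilon>[OF c(2)] b(1) c(1) by simp
      then show "x \<in> {0}" by (auto simp: c(1) \<epsilon>_def assemble_def fun_eq_iff)
    qed
    ultimately have "complex_dim (?S (insert t F)) = complex_dim (\<epsilon> ` W t) + complex_dim (?S F)"
      using complex_dim_direct_sum[OF sub\<epsilon> coord\<epsilon> subspace coord finite_I] by simp
    then show ?case using insert dim\<epsilon> by simp
  qed
qed

lemma join_add: "join (a + a') q = join a q + join a' q"
  by (auto simp: join_def assemble_def fun_eq_iff algebra_simps)

lemma join_scale: "join (\<lambda>t. c * a t) q = (\<lambda>i. c * join a q i)"
  by (auto simp: join_def assemble_def fun_eq_iff)

text \<open>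
  The sum of the weight directions and the block directions is direct, since only the former change the
  masses of the blocks. The contribution of the weights is the same at all points, so only the
  blocks can make the dimension vary.
\<close>

lemma complex_dim_tangent_space_join:
  assumes v: "(\<Sum>t\<in>T. v t) = 1" and vnz: "\<And>t. t \<in> T \<Longrightarrow> v t \<noteq> 0"
    and q: "\<And>t. t \<in> T \<Longrightarrow> q t \<in> Y"
  shows "complex_dim (tangent_space I X (join v q)) =
    complex_dim {a \<in> coord_space T. (\<Sum>t\<in>T. a t) = 0} +
    (\<Sum>t\<in>T. complex_dim (tangent_space J Y (q t)))"
proof -
  define H where "H = {a \<in> coord_space T. (\<Sum>t\<in>T. a t) = 0}"
  define U where "U = (\<lambda>a. join a q) ` H"
  define S where "S = {assemble b | b. \<forall>t\<in>T. b t \<in> (if t \<in> T then tangent_space J Y (q t) else {0})}"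
  have H: "cfun.subspace H"
    by (auto simp: H_def cfun.subspace_def coord_space_def sum.distrib simp flip: sum_distrib_left)
  have mass: "mass t (join a q) = a t" if "t \<in> T" for t a
    using that Y_total[OF q[OF that]] by (rule mass_join)
  have "inj_on (\<lambda>a. join a q) H"
  proof (rule inj_onI)
    fix a a' assume a: "a \<in> H" "a' \<in> H" "join a q = join a' q"
    have "a t = a' t" if "t \<in> T" for t using mass[OF that] a(3) by metis
    then show "a = a'" using a(1,2) by (force simp: H_def coord_space_def)
  qed
  then have dimU: "complex_dim U = complex_dim H"
    unfolding U_def by (intro complex_dim_injective_image H join_add join_scale)
  have U: "cfun.subspace U"
    unfolding U_def by (rule subspace_linear_image[OF H join_add join_scale])
  have S_eq: "S = {assemble b | b. \<forall>t\<in>T. b t \<in> tangent_space J Y (q t)}"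
    by (auto simp: S_def)
  have S: "cfun.subspace S"
    unfolding S_eq by (rule subspace_assemble) (rule subspace_tangent_space)
  have "tangent_space I X (join v q) = {x + y | x y. x \<in> U \<and> y \<in> S}"
  proof -
    have "\<exists>a'\<in>H. join a q = join a' q" if "(\<Sum>t\<in>T. a t) = 0" for a
    proof
      define a' where "a' t = (if t \<in> T then a t else 0)" for t
      show "a' \<in> H" using that by (simp add: H_def a'_def coord_space_def)
      show "join a q = join a' q" unfolding join_def by (rule assemble_cong) (simp add: a'_def)
    qed
    then have U_eq: "U = {join a q | a. (\<Sum>t\<in>T. a t) = 0}" unfolding U_def by (auto simp: H_def)
    have "tangent_space I X (join v q) =
      {join a q + assemble b | a b. (\<Sum>t\<in>T. a t) = 0 \<and> (\<forall>t\<in>T. b t \<in> tangent_space J Y (q t))}"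
      using v vnz q by (rule tangent_space_join)
    then show ?thesis unfolding U_eq S_eq by blast
  qed
  moreover have "U \<inter> S \<subseteq> {0}"
  proof
    fix x assume x: "x \<in> U \<inter> S"
    then obtain a b where a: "x = join a q" and b: "x = assemble b"
      "\<forall>t\<in>T. b t \<in> tangent_space J Y (q t)" unfolding U_def S_eq by blast
    have "a t = 0" if t: "t \<in> T" for t
      using mass[OF t, of a] mass_assemble[OF t, of b] tangent_Y_total b t a by metis
    then have "x = assemble (\<lambda>_ _. 0)" unfolding a join_def by (intro assemble_cong) simp
    then show "x \<in> {0}" by (simp add: assemble_def fun_eq_iff)
  qed
  moreover have "U \<subseteq> coord_space I" "S \<subseteq> coord_space I"
    by (auto simp: U_def S_def join_in_coord_space assemble_in_coord_space)
  ultimately have "complex_dim (tangent_space I X (join v q)) = complex_dim U + complex_dim S"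
    using complex_dim_direct_sum[OF U _ S _ finite_I] by simp
  also have "complex_dim S = (\<Sum>t\<in>T. complex_dim (tangent_space J Y (q t)))"
    unfolding S_def
    by (rule complex_dim_assemble) (auto simp: subspace_tangent_space, simp add: tangent_space_def)
  finally show ?thesis using dimU by (simp add: H_def)
qed


text \<open>
  A neighbourhood of \<open>join v q\<close> restricts to a neighbourhood of \<open>q\<^sup>t\<close> when only this argument varies, and
  then only its summand in the dimension formula can change.
\<close>

lemma smooth_join_slot:
  assumes v: "(\<Sum>t\<in>T. v t) = 1" and vnz: "\<And>t. t \<in> T \<Longrightarrow> v t \<noteq> 0"
    and q: "\<And>t. t \<in> T \<Longrightarrow> q t \<in> Y"
    and smooth: "smooth_point I X (join v q)" and t: "t \<in> T"
  shows "smooth_point J Y (q t)"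
proof -
  obtain g where g: "g \<in> poly_funs I" "g (join v q) \<noteq> 0"
    and dim: "\<And>p. p \<in> X \<Longrightarrow> g p \<noteq> 0 \<Longrightarrow>
      complex_dim (tangent_space I X p) = complex_dim (tangent_space I X (join v q))"
    using smooth unfolding smooth_point_def by blast
  define h where "h = (\<lambda>x. g (join v (q(t := x))))"
  have "complex_dim (tangent_space J Y x) = complex_dim (tangent_space J Y (q t))"
    if x: "x \<in> Y" "h x \<noteq> 0" for x
  proof -
    have q': "(q(t := x)) t' \<in> Y" if "t' \<in> T" for t' using q[OF that] x by simp
    have "complex_dim (tangent_space I X (join v (q(t := x)))) =
        complex_dim (tangent_space I X (join v q))"
      using x(2) by (intro dim join_in_X[OF v q']) (auto simp: h_def)
    then have "(\<Sum>t'\<in>T. complex_dim (tangent_space J Y ((q(t := x)) t'))) =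
        (\<Sum>t'\<in>T. complex_dim (tangent_space J Y (q t')))"
      using complex_dim_tangent_space_join[where q = q, OF v vnz q]
        complex_dim_tangent_space_join[where q = "q(t := x)", OF v vnz q'] by simp
    then show ?thesis by (simp add: sum.remove[OF finite_T t])
  qed
  moreover have "h \<in> poly_funs J" unfolding h_def by (rule join_poly_slot[OF g(1)])
  moreover have "h (q t) \<noteq> 0" using g(2) by (simp add: h_def)
  ultimately show ?thesis using q[OF t] unfolding smooth_point_def by blast
qed

text \<open>
  Neighbourhoods \<open>{g \<noteq> 0}\<close> of the \<open>q\<^sup>t\<close> pull back, after homogenisation, to neighbourhoods of
  \<open>join v q\<close>.
\<close>

lemma smooth_joinI:
  assumes v: "(\<Sum>t\<in>T. v t) = 1" and vnz: "\<And>t. t \<in> T \<Longrightarrow> v t \<noteq> 0"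
    and smooth: "\<And>t. t \<in> T \<Longrightarrow> smooth_point J Y (q t)"
  shows "smooth_point I X (join v q)"
proof -
  have q: "q t \<in> Y" if "t \<in> T" for t using smooth[OF that] by (simp add: smooth_point_def)
  have "\<exists>G\<in>poly_funs I. \<forall>v q. v t \<noteq> 0 \<longrightarrow> q t \<in> Y \<longrightarrow>
      (G (join v q) \<noteq> 0 \<longrightarrow>
        complex_dim (tangent_space J Y (q t)) = complex_dim (tangent_space J Y (q0 t))) \<and>
      (q t = q0 t \<longrightarrow> G (join v q) \<noteq> 0)"
    if t: "t \<in> T" and smooth0: "smooth_point J Y (q0 t)" for t and q0 :: "'t \<Rightarrow> 'j \<Rightarrow> complex"
  proof -
    obtain g where g: "g \<in> poly_funs J" "g (q0 t) \<noteq> 0"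
      and dim: "\<And>x. x \<in> Y \<Longrightarrow> g x \<noteq> 0 \<Longrightarrow>
        complex_dim (tangent_space J Y x) = complex_dim (tangent_space J Y (q0 t))"
      using smooth0 unfolding smooth_point_def by blast
    obtain G e where G: "G \<in> poly_funs I"
      "\<And>x. mass t x \<noteq> 0 \<Longrightarrow> G x = mass t x ^ e * g (\<lambda>j. block t x j / mass t x)"
      using poly_funs_clear_denominator[where \<sigma> = "mass t" and \<phi> = "block t",
          OF g(1) mass_poly[OF t] block_poly[OF t]] by metis
    have "G (join v q) = v t ^ e * g (q t)" if "v t \<noteq> 0" "q t \<in> Y" for v q
    proof -
      have m: "mass t (join v q) = v t" using t Y_total[OF that(2)] by (rule mass_join)
      have "g (\<lambda>j. block t (join v q) j / mass t (join v q)) = g (q t)"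
        using that(1) by (intro poly_funs_cong[OF g(1)]) (simp add: m block_join t)
      then show ?thesis using G(2)[of "join v q"] that(1) m by simp
    qed
    then show ?thesis using G(1) dim g(2) by (intro bexI[of _ G]) auto
  qed
  then have "\<forall>t\<in>T. \<exists>G\<in>poly_funs I. \<forall>v' q'. v' t \<noteq> 0 \<longrightarrow> q' t \<in> Y \<longrightarrow>
      (G (join v' q') \<noteq> 0 \<longrightarrow>
        complex_dim (tangent_space J Y (q' t)) = complex_dim (tangent_space J Y (q t))) \<and>
      (q' t = q t \<longrightarrow> G (join v' q') \<noteq> 0)"
    using smooth by blast
  then obtain G where Gp: "\<And>t. t \<in> T \<Longrightarrow> G t \<in> poly_funs I"
    and G: "\<And>t v' q'. t \<in> T \<Longrightarrow> v' t \<noteq> 0 \<Longrightarrow> q' t \<in> Y \<Longrightarrow>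
      (G t (join v' q') \<noteq> 0 \<longrightarrow>
        complex_dim (tangent_space J Y (q' t)) = complex_dim (tangent_space J Y (q t))) \<and>
      (q' t = q t \<longrightarrow> G t (join v' q') \<noteq> 0)"
    by metis
  \<comment> \<open>Nonvanishing of the masses keeps \<open>{h \<noteq> 0}\<close> inside the image of the parametrisation.\<close>
  define h where "h = (\<lambda>p. \<Prod>t\<in>T. mass t p * G t p)"
  have h: "h \<in> poly_funs I"
    unfolding h_def by (intro poly_funs_prod poly_funs.mult mass_poly Gp)
  have "h (join v q) \<noteq> 0"
    using vnz q G[of _ v q] mass_join[of _ q v] Y_total finite_T by (simp add: h_def)
  moreover have "complex_dim (tangent_space I X p) = complex_dim (tangent_space I X (join v q))"
    if p: "p \<in> X" "h p \<noteq> 0" for p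
  proof -
    have nz: "mass t p \<noteq> 0" "G t p \<noteq> 0" if "t \<in> T" for t
      using p(2) that finite_T by (auto simp: h_def)
    obtain q' where q': "\<And>t. t \<in> T \<Longrightarrow> q' t \<in> Y" "p = join (\<lambda>t. mass t p) q'"
      using X_elim_join[OF p(1) nz(1)] by blast
    have v': "(\<Sum>t\<in>T. mass t p) = 1" using X_total[OF p(1)] by (simp add: sum_mass)
    have "complex_dim (tangent_space J Y (q' t)) = complex_dim (tangent_space J Y (q t))"
      if t: "t \<in> T" for t
      using G[of t "\<lambda>t. mass t p" q'] t nz[OF t] q'(1)[OF t] q'(2) by simp
    then have "(\<Sum>t\<in>T. complex_dim (tangent_space J Y (q' t))) =
        (\<Sum>t\<in>T. complex_dim (tangent_space J Y (q t)))" by simp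
    then show ?thesis
      using complex_dim_tangent_space_join[where q = q, OF v vnz q]
        complex_dim_tangent_space_join[where q = q' and v = "\<lambda>t. mass t p", OF v' nz(1) q'(1)]
        q'(2) by simp
  qed
  moreover have "join v q \<in> X" using v q by (rule join_in_X)
  ultimately show ?thesis
    using h unfolding smooth_point_def by blast
qed

lemma complexified_N_in_Y: "r \<in> N \<Longrightarrow> (\<lambda>j. complex_of_real (r j)) \<in> Y"
  using N_simplex zariski_closure_superset[of "(\<lambda>p i. complex_of_real (p i)) ` N" J]
    complexified_simplex_subset[of J]
  unfolding model_variety_def by blast

text \<open>
  Increasing the mass of block \<open>t\<close> and renormalising is a flow on the glued model. Its velocity is
  polynomial in \<open>p\<close>, so it is tangent at every point of \<open>X\<close>, also at the points where some block has mass
  \<open>0\<close>, which the parametrisation need not reach.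
\<close>

lemma euler_field_tangent:
  assumes t: "t \<in> T" and p: "p \<in> X"
  shows "assemble (\<lambda>t' j. ((if t' = t then 1 else 0) - mass t p) * block t' p j) \<in> tangent_space I X p"
    (is "?e p \<in> _")
  unfolding tangent_space_def
proof (intro CollectI conjI ballI assemble_in_coord_space)
  fix f assume f: "f \<in> vanishing_ideal I X"
  then have fp: "f \<in> poly_funs I" by (simp add: vanishing_X)
  define h where "h = (\<lambda>p. \<Sum>i\<in>I. partial_deriv i f p * ?e p i)"
  have "h \<in> vanishing_ideal I X"
    unfolding vanishing_X_iff
  proof (intro conjI allI impI)
    show "h \<in> poly_funs I"
      unfolding h_def
      by (intro poly_funs_sum poly_funs.mult partial_deriv_poly_funs[OF fp] assemble_poly
          poly_funs_diff poly_funs.const mass_poly[OF t] block_poly)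
  next
    fix v q assume v: "v \<in> open_simplex T" and q: "\<forall>t\<in>T. q t \<in> N"
    define v' where "v' = (\<lambda>t. complex_of_real (v t))"
    define q' where "q' = (\<lambda>t j. complex_of_real (q t j))"
    have v'1: "(\<Sum>t\<in>T. v' t) = 1"
      using v by (simp add: v'_def open_simplex_def flip: of_real_sum)
    have q'Y: "q' t \<in> Y" if "t \<in> T" for t
      using q that complexified_N_in_Y by (simp add: q'_def)
    have m: "mass t (join v' q') = v' t" using t Y_total[OF q'Y[OF t]] by (rule mass_join)
    define a where "a = (\<lambda>t'. ((if t' = t then 1 else 0) - v' t) * v' t')"
    have "(\<Sum>t'\<in>T. a t') = v' t - v' t * (\<Sum>t'\<in>T. v' t')"
      using t finite_T
      by (simp add: a_def left_diff_distrib sum_subtractf sum_distrib_left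
          if_distrib[of "\<lambda>c. c * _"] cong: if_cong)
    then have "join a q' \<in> tangent_space I X (join v' q')"
      using v'1 by (intro tangent_weights[OF v'1 q'Y]) auto
    moreover have "?e (join v' q') = join a q'"
      unfolding m unfolding join_def
      by (rule assemble_cong) (simp add: a_def block_assemble mult.assoc)
    ultimately show "h (join (\<lambda>t. of_real (v t)) (\<lambda>t j. of_real (q t j))) = 0"
      using f unfolding h_def tangent_space_def v'_def q'_def by simp
  qed
  from vanishing_idealD[OF this p] show "(\<Sum>i\<in>I. partial_deriv i f p * ?e p i) = 0"
    by (simp add: h_def)
qed

text \<open>
  The score equation in the direction of this field determines the mass of each block, and excludes critical
  points with a block of mass \<open>0\<close> as soon as the total counts \<open>mass t u\<close> of the data are nonzero.
\<close>

lemma critical_point_mass: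
  assumes t: "t \<in> T" and p: "p \<in> critical_points I X u"
  shows "mass t u = mass t p * (\<Sum>i\<in>I. u i)"
proof -
  have pX: "p \<in> X" and nz: "\<And>i. i \<in> I \<Longrightarrow> p i \<noteq> 0"
    using p by (auto simp: critical_points_def smooth_point_def)
  define e where "e = assemble (\<lambda>t' j. ((if t' = t then 1 else 0) - mass t p) * block t' p j)"
  have "0 = (\<Sum>i\<in>I. u i / p i * e i)"
    using p euler_field_tangent[OF t pX] unfolding critical_points_def e_def by simp
  also have "\<dots> = (\<Sum>i\<in>I. ((if \<tau> i = t then 1 else 0) - mass t p) * block (\<tau> i) u (\<rho> i))"
    using nz by (intro sum.cong) (auto simp: e_def assemble_def block_eq)
  also have "\<dots> = (\<Sum>t'\<in>T. \<Sum>j\<in>J. ((if t' = t then 1 else 0) - mass t p) * block t' u j)"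
    by (rule sum_blocks)
  also have "\<dots> = (\<Sum>t'\<in>T. ((if t' = t then 1 else 0) - mass t p) * mass t' u)"
    by (simp add: mass_def sum_distrib_left)
  also have "\<dots> = mass t u - mass t p * (\<Sum>t'\<in>T. mass t' u)"
    using t finite_T
    by (simp add: left_diff_distrib sum_subtractf sum_distrib_left
        if_distrib[of "\<lambda>c. c * _"] cong: if_cong)
  finally show ?thesis by (simp add: sum_mass)
qed

lemma score_join:
  assumes "\<And>t. t \<in> T \<Longrightarrow> v t \<noteq> 0" and "\<And>t j. t \<in> T \<Longrightarrow> j \<in> J \<Longrightarrow> q t j \<noteq> 0"
  shows "(\<Sum>i\<in>I. u i / join v q i * (join a q + assemble b) i) =
    (\<Sum>t\<in>T. a t * (mass t u / v t)) + (\<Sum>t\<in>T. (\<Sum>j\<in>J. block t u j / q t j * b t j) / v t)"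
proof -
  have "(\<Sum>i\<in>I. u i / join v q i * (join a q + assemble b) i) =
      (\<Sum>i\<in>I. block (\<tau> i) u (\<rho> i) / (v (\<tau> i) * q (\<tau> i) (\<rho> i)) *
        (a (\<tau> i) * q (\<tau> i) (\<rho> i) + b (\<tau> i) (\<rho> i)))"
    by (intro sum.cong) (auto simp: join_def assemble_def block_eq)
  also have "\<dots> = (\<Sum>t\<in>T. \<Sum>j\<in>J. block t u j / (v t * q t j) * (a t * q t j + b t j))"
    by (rule sum_blocks[of "\<lambda>t j. block t u j / (v t * q t j) * (a t * q t j + b t j)"])
  also have "\<dots> = (\<Sum>t\<in>T. \<Sum>j\<in>J. a t * (block t u j / v t) + block t u j / q t j * b t j / v t)"
    using assms by (intro sum.cong refl) (auto simp: field_simps)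
  also have "\<dots> = (\<Sum>t\<in>T. a t * (mass t u / v t)) + (\<Sum>t\<in>T. (\<Sum>j\<in>J. block t u j / q t j * b t j) / v t)"
    by (simp add: sum.distrib mass_def sum_distrib_left sum_divide_distrib)
  finally show ?thesis .
qed


lemma critical_points_smooth: "p \<in> critical_points K Z u \<Longrightarrow> smooth_point K Z p"
  by (simp add: critical_points_def)

lemma critical_points_subset: "critical_points K Z u \<subseteq> Z"
  by (auto simp: critical_points_def smooth_point_def)

text \<open>
  The gradient of the log-likelihood pairs with \<open>join a q\<close> to \<open>\<Sum>\<^sub>t a\<^sub>t (u\<^sub>t\<^sub>+ / v\<^sub>t)\<close>. With the weights
  \<open>v\<^sub>t = u\<^sub>t\<^sub>+ / u\<^sub>+\<^sub>+\<close> this is a multiple of \<open>\<Sum>\<^sub>t a\<^sub>t = 0\<close>, and what remains are separate score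
  equations for the blocks.
\<close>

lemma join_critical_iff:
  assumes tot: "(\<Sum>i\<in>I. u i) \<noteq> 0" and mu: "\<And>t. t \<in> T \<Longrightarrow> mass t u \<noteq> 0"
    and v: "\<And>t. t \<in> T \<Longrightarrow> v t = mass t u / (\<Sum>i\<in>I. u i)"
    and q: "\<And>t. t \<in> T \<Longrightarrow> q t \<in> Y"
  shows "join v q \<in> critical_points I X u \<longleftrightarrow>
    (\<forall>t\<in>T. q t \<in> critical_points J Y (block t u))"
proof -
  have vnz: "v t \<noteq> 0" if "t \<in> T" for t using v mu tot that by simp
  have v1: "(\<Sum>t\<in>T. v t) = 1"
    using tot by (simp add: v sum_mass flip: sum_divide_distrib)
  have ratio: "mass t u / v t = (\<Sum>i\<in>I. u i)" if "t \<in> T" for t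
    using v[OF that] mu[OF that] tot by simp
  have score: "(\<Sum>i\<in>I. u i / join v q i * (join a q + assemble b) i) =
      (\<Sum>t\<in>T. (\<Sum>j\<in>J. block t u j / q t j * b t j) / v t)"
    if "\<And>t j. t \<in> T \<Longrightarrow> j \<in> J \<Longrightarrow> q t j \<noteq> 0" "(\<Sum>t\<in>T. a t) = 0" for a b
  proof -
    have "(\<Sum>t\<in>T. a t * (mass t u / v t)) = (\<Sum>t\<in>T. a t) * (\<Sum>i\<in>I. u i)"
      by (simp add: ratio sum_distrib_right)
    moreover have "(\<Sum>i\<in>I. u i / join v q i * (join a q + assemble b) i) =
        (\<Sum>t\<in>T. a t * (mass t u / v t)) + (\<Sum>t\<in>T. (\<Sum>j\<in>J. block t u j / q t j * b t j) / v t)"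
      using vnz that(1) by (rule score_join)
    ultimately show ?thesis using that(2) by simp
  qed
  have nz_iff: "(\<forall>i\<in>I. join v q i \<noteq> 0) \<longleftrightarrow> (\<forall>t\<in>T. \<forall>j\<in>J. q t j \<noteq> 0)"
  proof
    assume L: "\<forall>i\<in>I. join v q i \<noteq> 0"
    have "v t * q t j \<noteq> 0" if "t \<in> T" "j \<in> J" for t j
    proof -
      have eq: "join v q (inv_into I (\<lambda>i. (\<tau> i, \<rho> i)) (t, j)) = v t * q t j"
        using block_join[OF that, of v q] that by (simp add: block_def)
      show ?thesis unfolding eq[symmetric] using L block_index_at(1)[OF that] by blast
    qed
    then show "\<forall>t\<in>T. \<forall>j\<in>J. q t j \<noteq> 0" by auto
  next
    assume "\<forall>t\<in>T. \<forall>j\<in>J. q t j \<noteq> 0"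
    then show "\<forall>i\<in>I. join v q i \<noteq> 0"
      using vnz by (simp add: join_def assemble_def \<tau>_in \<rho>_in)
  qed
  have tangent: "tangent_space I X (join v q) =
    {join a q + assemble b | a b. (\<Sum>t\<in>T. a t) = 0 \<and> (\<forall>t\<in>T. b t \<in> tangent_space J Y (q t))}"
    using v1 vnz q by (rule tangent_space_join)
  show ?thesis
  proof
    assume crit: "join v q \<in> critical_points I X u"
    then have nz: "\<forall>t\<in>T. \<forall>j\<in>J. q t j \<noteq> 0" using nz_iff by (simp add: critical_points_def)
    show "\<forall>t\<in>T. q t \<in> critical_points J Y (block t u)"
    proof
      fix t assume t: "t \<in> T"
      have smooth: "smooth_point J Y (q t)"
        using v1 vnz q critical_points_smooth[OF crit] t by (rule smooth_join_slot)
      have "(\<Sum>j\<in>J. block t u j / q t j * b j) = 0" if b: "b \<in> tangent_space J Y (q t)" for b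
      proof -
        define b' where "b' = (\<lambda>_ :: 't. (0 :: 'j \<Rightarrow> complex))(t := b)"
        have "\<forall>t'\<in>T. b' t' \<in> tangent_space J Y (q t')"
          using b by (simp add: b'_def cfun.subspace_0[OF subspace_tangent_space])
        then have "join (\<lambda>_. 0) q + assemble b' \<in> tangent_space I X (join v q)"
          unfolding tangent by (intro CollectI exI[of _ "\<lambda>_. 0"] exI[of _ b']) simp
        then have "0 = (\<Sum>i\<in>I. u i / join v q i * (join (\<lambda>_. 0) q + assemble b') i)"
          using crit by (simp only: critical_points_def mem_Collect_eq)
        also have "\<dots> = (\<Sum>t'\<in>T. (\<Sum>j\<in>J. block t' u j / q t' j * b' t' j) / v t')"
          using nz by (intro score) auto
        also have "\<dots> = (\<Sum>t'\<in>T. if t' = t then (\<Sum>j\<in>J. block t u j / q t j * b j) / v t else 0)"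
          by (intro sum.cong) (auto simp: b'_def)
        also have "\<dots> = (\<Sum>j\<in>J. block t u j / q t j * b j) / v t"
          using t finite_T by simp
        finally show ?thesis using vnz[OF t] by simp
      qed
      then show "q t \<in> critical_points J Y (block t u)"
        using smooth nz t by (simp add: critical_points_def)
    qed
  next
    assume crit: "\<forall>t\<in>T. q t \<in> critical_points J Y (block t u)"
    have nz: "q t j \<noteq> 0" if "t \<in> T" "j \<in> J" for t j
      using crit that by (simp add: critical_points_def)
    have "smooth_point I X (join v q)"
      by (rule smooth_joinI[OF v1 vnz]) (use crit in \<open>auto simp: critical_points_def\<close>)
    moreover have "(\<Sum>i\<in>I. u i / join v q i * w i) = 0" if w: "w \<in> tangent_space I X (join v q)" for w
    proof -
      obtain a b where ab: "w = join a q + assemble b" "(\<Sum>t\<in>T. a t) = 0"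
        "\<forall>t\<in>T. b t \<in> tangent_space J Y (q t)" using w unfolding tangent by blast
      have "(\<Sum>j\<in>J. block t u j / q t j * b t j) = 0" if "t \<in> T" for t
        using crit ab(3) that by (auto simp: critical_points_def)
      moreover have "(\<Sum>i\<in>I. u i / join v q i * w i) =
          (\<Sum>t\<in>T. (\<Sum>j\<in>J. block t u j / q t j * b t j) / v t)"
        unfolding ab(1) using nz ab(2) by (rule score)
      ultimately show ?thesis by (simp del: times_divide_eq_left)
    qed
    ultimately show "join v q \<in> critical_points I X u"
      using nz_iff nz by (simp add: critical_points_def)
  qed
qed

lemma critical_points_bij:
  assumes tot: "(\<Sum>i\<in>I. u i) \<noteq> 0" and mu: "\<And>t. t \<in> T \<Longrightarrow> mass t u \<noteq> 0"
  shows "bij_betw (join (\<lambda>t. mass t u / (\<Sum>i\<in>I. u i)))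
    (\<Pi>\<^sub>E t\<in>T. critical_points J Y (block t u)) (critical_points I X u)"
proof -
  define v where "v = (\<lambda>t. mass t u / (\<Sum>i\<in>I. u i))"
  have vnz: "v t \<noteq> 0" if "t \<in> T" for t using mu tot that by (simp add: v_def)
  have Y: "q t \<in> Y" if "q \<in> (\<Pi>\<^sub>E t\<in>T. critical_points J Y (block t u))" "t \<in> T" for q t
    using PiE_mem[OF that] critical_points_subset by blast
  have "inj_on (join v) (\<Pi>\<^sub>E t\<in>T. critical_points J Y (block t u))"
  proof (rule inj_onI)
    fix q q' assume q: "q \<in> (\<Pi>\<^sub>E t\<in>T. critical_points J Y (block t u))"
      "q' \<in> (\<Pi>\<^sub>E t\<in>T. critical_points J Y (block t u))" and eq: "join v q = join v q'"
    show "q = q'"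
    proof (rule PiE_ext[OF q])
      fix t assume t: "t \<in> T"
      have "q t j = q' t j" if "j \<in> J" for j
        using block_join[OF t that, of v q] block_join[OF t that, of v q'] eq vnz[OF t] by simp
      moreover have "q t \<in> coord_space J" "q' t \<in> coord_space J"
        using Y_coord Y q t by blast+
      ultimately show "q t = q' t" by (fastforce simp: coord_space_def)
    qed
  qed
  moreover have "join v ` (\<Pi>\<^sub>E t\<in>T. critical_points J Y (block t u)) = critical_points I X u"
  proof (intro equalityI subsetI)
    fix p assume "p \<in> join v ` (\<Pi>\<^sub>E t\<in>T. critical_points J Y (block t u))"
    then obtain q where q: "p = join v q" "q \<in> (\<Pi>\<^sub>E t\<in>T. critical_points J Y (block t u))" by blast
    have "\<forall>t\<in>T. q t \<in> critical_points J Y (block t u)" using q(2) by (auto dest: PiE_mem)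
    then show "p \<in> critical_points I X u"
      unfolding q(1) using Y[OF q(2)] by (subst join_critical_iff[OF tot mu]) (auto simp: v_def)
  next
    fix p assume p: "p \<in> critical_points I X u"
    have m: "mass t p = v t" if "t \<in> T" for t
      using critical_point_mass[OF that p] tot by (simp add: v_def)
    have pX: "p \<in> X" using p critical_points_subset by blast
    obtain q where q: "\<And>t. t \<in> T \<Longrightarrow> q t \<in> Y" "p = join (\<lambda>t. mass t p) q"
      using X_elim_join[OF pX] m vnz by metis
    have p_eq: "p = join v (restrict q T)"
      by (subst q(2), unfold join_def, rule assemble_cong) (simp add: m)
    have "\<forall>t\<in>T. restrict q T t \<in> critical_points J Y (block t u)"
      using p unfolding p_eq by (subst (asm) join_critical_iff[OF tot mu]) (auto simp: v_def q(1))
    then have "restrict q T \<in> (\<Pi>\<^sub>E t\<in>T. critical_points J Y (block t u))"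
      by (auto simp: PiE_iff)
    then show "p \<in> join v ` (\<Pi>\<^sub>E t\<in>T. critical_points J Y (block t u))" using p_eq by blast
  qed
  ultimately show ?thesis by (simp add: bij_betw_def v_def)
qed

end

section \<open>Generic data\<close>

lemma generic_critical_count_unique:
  assumes "generic_critical_count I M m" "generic_critical_count I M n"
  shows "m = n"
proof -
  obtain g where g: "g \<in> poly_funs I" "\<exists>u\<in>coord_space I. g u \<noteq> 0"
    "\<forall>u\<in>coord_space I. g u \<noteq> 0 \<longrightarrow> card (critical_points I (model_variety I M) u) = m"
    using assms(1) unfolding generic_critical_count_def by blast
  obtain h where h: "h \<in> poly_funs I" "\<exists>u\<in>coord_space I. h u \<noteq> 0"
    "\<forall>u\<in>coord_space I. h u \<noteq> 0 \<longrightarrow> card (critical_points I (model_variety I M) u) = n"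
    using assms(2) unfolding generic_critical_count_def by blast
  obtain u where "u \<in> coord_space I" "g u \<noteq> 0" "h u \<noteq> 0"
    using poly_funs_mult_nonzero[of g I h] g(1,2) h(1,2) by blast
  then show ?thesis using g(3) h(3) by auto
qed

lemma MLdeg_eq: "generic_critical_count I M n \<Longrightarrow> MLdeg I M = n"
  unfolding MLdeg_def using generic_critical_count_unique[of I M] by (auto intro: the_equality)

context glued_model
begin

text \<open>
  Where this polynomial is nonzero, the critical points of the glued model are the tuples of critical points
  of the blocks.
\<close>

definition regular_data :: "('i \<Rightarrow> complex) \<Rightarrow> complex" where
  "regular_data u = (\<Prod>t\<in>T. mass t u) * (\<Sum>i\<in>I. u i)"

lemma regular_data_poly: "regular_data \<in> poly_funs I"
  unfolding regular_data_def[abs_def]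
  by (intro poly_funs.mult poly_funs_prod poly_funs_sum mass_poly poly_funs.coord)

lemma regular_data_nonzero: "regular_data (assemble (\<lambda>_ _. 1)) \<noteq> 0"
  using finite_T T_nonempty finite_J J_nonempty
  by (simp add: regular_data_def sum_mass mass_assemble card_eq_0_iff)

lemma critical_points_product:
  assumes "regular_data u \<noteq> 0"
  obtains f where "bij_betw f (\<Pi>\<^sub>E t\<in>T. critical_points J Y (block t u)) (critical_points I X u)"
proof -
  have "(\<Sum>i\<in>I. u i) \<noteq> 0" "\<And>t. t \<in> T \<Longrightarrow> mass t u \<noteq> 0"
    using assms finite_T by (auto simp: regular_data_def)
  then show ?thesis using that critical_points_bij by blast
qed

lemma card_critical_points:
  assumes "regular_data u \<noteq> 0"
  shows "card (critical_points I X u) = (\<Prod>t\<in>T. card (critical_points J Y (block t u)))"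
  using critical_points_product[OF assms] by (metis bij_betw_same_card card_PiE finite_T)

lemma generic_critical_count_glue:
  assumes "generic_critical_count J N n"
  shows "generic_critical_count I (glue N) (n ^ card T)"
proof -
  obtain g where g: "g \<in> poly_funs J" "\<exists>x\<in>coord_space J. g x \<noteq> 0"
    and crit: "\<And>x. x \<in> coord_space J \<Longrightarrow> g x \<noteq> 0 \<Longrightarrow>
      finite (critical_points J Y x) \<and> card (critical_points J Y x) = n"
    using assms unfolding generic_critical_count_def by blast
  obtain x where x: "x \<in> coord_space J" "g x \<noteq> 0" using g(2) by blast
  define h where "h = (\<lambda>u. \<Prod>t\<in>T. g (block t u))"
  have h: "h \<in> poly_funs I"
    unfolding h_def by (intro poly_funs_prod poly_funs_compose[OF g(1)] block_poly)
  have "block t (assemble (\<lambda>_. x)) = x" if "t \<in> T" for t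
    using that x(1) by (intro block_assemble_fun)
  then have "h (assemble (\<lambda>_. x)) \<noteq> 0"
    using x(2) finite_T by (simp add: h_def)
  then obtain u0 where u0: "u0 \<in> coord_space I" "h u0 \<noteq> 0" "regular_data u0 \<noteq> 0"
    using poly_funs_mult_nonzero[OF h regular_data_poly assemble_in_coord_space _
        assemble_in_coord_space regular_data_nonzero] by blast
  show ?thesis
    unfolding generic_critical_count_def
  proof (intro bexI[of _ "\<lambda>u. h u * regular_data u"] conjI ballI impI)
    show "\<exists>u\<in>coord_space I. h u * regular_data u \<noteq> 0" using u0 by auto
    show "(\<lambda>u. h u * regular_data u) \<in> poly_funs I"
      by (rule poly_funs.mult[OF h regular_data_poly])
    fix u assume u: "h u * regular_data u \<noteq> 0"
    then have reg: "regular_data u \<noteq> 0" by simp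
    have c: "finite (critical_points J Y (block t u)) \<and> card (critical_points J Y (block t u)) = n"
      if "t \<in> T" for t
    proof (rule crit[OF block_in_coord_space])
      show "g (block t u) \<noteq> 0" using u that finite_T by (auto simp: h_def)
    qed
    then show "card (critical_points I X u) = n ^ card T"
      by (simp add: card_critical_points[OF reg])
    have "finite (\<Pi>\<^sub>E t\<in>T. critical_points J Y (block t u))"
      using c by (intro finite_PiE finite_T) blast
    then show "finite (critical_points I X u)"
      using critical_points_product[OF reg] bij_betw_finite by blast
  qed
qed

text \<open>
  Conversely, a nonzero generic count for the glued model gives one for the factors: fixing generic data
  in all blocks but one, the count in the remaining block is the total count divided by a constant.
\<close>

lemma generic_critical_count_factor:
  assumes "generic_critical_count I (glue N) n" and n: "n \<noteq> 0"
  shows "\<exists>m. generic_critical_count J N m"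
proof -
  obtain g where g: "g \<in> poly_funs I" "\<exists>u\<in>coord_space I. g u \<noteq> 0"
    and crit: "\<And>u. u \<in> coord_space I \<Longrightarrow> g u \<noteq> 0 \<Longrightarrow> card (critical_points I X u) = n"
    using assms(1) unfolding generic_critical_count_def by blast
  obtain u0 where u0: "u0 \<in> coord_space I" "g u0 \<noteq> 0" "regular_data u0 \<noteq> 0"
    using g(2) poly_funs_mult_nonzero[OF g(1) regular_data_poly _ _
        assemble_in_coord_space regular_data_nonzero] by blast
  obtain t0 where t0: "t0 \<in> T" using T_nonempty by blast
  define w where "w = (\<lambda>x. assemble ((\<lambda>t. block t u0)(t0 := x)))"
  define h where "h = (\<lambda>x. g (w x) * regular_data (w x))"
  define K where "K = (\<Prod>t\<in>T - {t0}. card (critical_points J Y (block t u0)))"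
  have w_poly: "(\<lambda>x. w x i) \<in> poly_funs J" for i
  proof -
    have "(\<lambda>x. ((\<lambda>t. block t u0)(t0 := x)) t j) \<in> poly_funs J" if "j \<in> J" for t j
      using that by (cases "t = t0") (auto intro: poly_funs.intros)
    then show ?thesis unfolding w_def by (rule assemble_poly)
  qed
  have h: "h \<in> poly_funs J"
    unfolding h_def
    by (intro poly_funs.mult poly_funs_compose[OF g(1)] poly_funs_compose[OF regular_data_poly] w_poly)
  have "w (block t0 u0) = assemble (\<lambda>t. block t u0)"
    unfolding w_def by (rule arg_cong[of _ _ assemble]) (auto simp: fun_eq_iff)
  also have "\<dots> = u0" using u0(1) by (intro assemble_block) (simp add: coord_space_def)
  finally have "h (block t0 u0) \<noteq> 0" using u0 by (simp add: h_def)
  moreover have "finite (critical_points J Y x) \<and> card (critical_points J Y x) = n div K"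
    if x: "x \<in> coord_space J" "h x \<noteq> 0" for x
  proof -
    have bl: "block t (w x) = (if t = t0 then x else block t u0)" if "t \<in> T" for t
    proof -
      have "((\<lambda>t. block t u0)(t0 := x)) t \<in> coord_space J"
        using x(1) block_in_coord_space[of t u0] by simp
      from block_assemble_fun[where x = "(\<lambda>t. block t u0)(t0 := x)", OF that this] show ?thesis by (simp add: w_def)
    qed
    have nz: "g (w x) \<noteq> 0" "regular_data (w x) \<noteq> 0" using x(2) by (auto simp: h_def)
    have "w x \<in> coord_space I" unfolding w_def by (rule assemble_in_coord_space)
    then have "n = card (critical_points I X (w x))" using nz(1) by (rule crit[symmetric])
    also have "\<dots> = (\<Prod>t\<in>T. card (critical_points J Y (block t (w x))))"
      using nz(2) by (rule card_critical_points)
    also have "\<dots> = (\<Prod>t\<in>T. card (critical_points J Y (if t = t0 then x else block t u0)))"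
      by (intro prod.cong refl) (simp only: bl)
    also have "\<dots> = card (critical_points J Y x) * K"
      unfolding prod.remove[OF finite_T t0] K_def by simp
    finally have n_eq: "n = card (critical_points J Y x) * K" .
    then have "K \<noteq> 0" and card: "card (critical_points J Y x) \<noteq> 0" using n by auto
    then have "card (critical_points J Y x) = n div K" by (simp add: n_eq)
    moreover have "finite (critical_points J Y x)" using card by (intro card_ge_0_finite) simp
    ultimately show ?thesis by blast
  qed
  ultimately have "generic_critical_count J N (n div K)"
    unfolding generic_critical_count_def
    using h block_in_coord_space by blast
  then show ?thesis by blast
qed

text \<open>
  If the factors have no generic count, both degrees are \<open>0\<close>: the one of \<open>N\<close> by default, and the one of the
  glued model by default or because its generic count is \<open>0\<close>.
\<close>

theorem MLdeg_glue: "MLdeg I (glue N) = MLdeg J N ^ card T"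
proof (cases "\<exists>n. generic_critical_count J N n")
  case True
  then obtain n where "generic_critical_count J N n" by blast
  then show ?thesis using MLdeg_eq generic_critical_count_glue by metis
next
  case False
  then have "MLdeg I (glue N) = 0"
    using generic_critical_count_factor MLdeg_eq unfolding MLdeg_def by metis
  moreover have "MLdeg J N = 0" using False by (simp add: MLdeg_def)
  moreover have "card T \<noteq> 0" using finite_T T_nonempty by simp
  ultimately show ?thesis by simp
qed

end

section \<open>Mixtures of glued models\<close>

lemma open_simplexI:
  "(\<And>i. i \<in> I \<Longrightarrow> 0 < p i) \<Longrightarrow> (\<And>i. i \<notin> I \<Longrightarrow> p i = 0) \<Longrightarrow> (\<Sum>i\<in>I. p i) = 1 \<Longrightarrow> p \<in> open_simplex I"
  by (simp add: open_simplex_def)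

lemma open_simplex_pos: "p \<in> open_simplex I \<Longrightarrow> i \<in> I \<Longrightarrow> 0 < p i"
  and open_simplex_outside: "p \<in> open_simplex I \<Longrightarrow> i \<notin> I \<Longrightarrow> p i = 0"
  and open_simplex_sum: "p \<in> open_simplex I \<Longrightarrow> (\<Sum>i\<in>I. p i) = 1"
  by (simp_all add: open_simplex_def)

lemma MixtI:
  "w \<in> open_simplex {1..r} \<Longrightarrow> (\<And>h. h \<in> {1..r} \<Longrightarrow> p h \<in> M) \<Longrightarrow>
    (\<lambda>i. \<Sum>h\<in>{1..r}. w h * p h i) \<in> Mixt r M"
  unfolding Mixt_def by blast

lemma Mixt_subset_simplex:
  assumes "N \<subseteq> open_simplex J"
  shows "Mixt r N \<subseteq> open_simplex J"
proof
  fix x assume "x \<in> Mixt r N"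
  then obtain w p where x: "x = (\<lambda>i. \<Sum>h\<in>{1..r}. w h * p h i)" and w: "w \<in> open_simplex {1..r}"
    and p: "\<And>h. h \<in> {1..r} \<Longrightarrow> p h \<in> open_simplex J"
    using assms unfolding Mixt_def by blast
  have ne: "{1..r} \<noteq> {}" using open_simplex_sum[OF w] by (cases r) auto
  show "x \<in> open_simplex J"
  proof (rule open_simplexI)
    show "0 < x i" if "i \<in> J" for i
      unfolding x using ne open_simplex_pos[OF w] open_simplex_pos[OF p that] by (intro sum_pos) auto
    show "x i = 0" if "i \<notin> J" for i
      unfolding x using open_simplex_outside[OF p that] by simp
    have "(\<Sum>i\<in>J. x i) = (\<Sum>h\<in>{1..r}. w h * (\<Sum>i\<in>J. p h i))"
      unfolding x by (subst sum.swap) (simp add: sum_distrib_left)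
    also have "\<dots> = 1" using open_simplex_sum[OF w] open_simplex_sum[OF p] by simp
    finally show "(\<Sum>i\<in>J. x i) = 1" .
  qed
qed

context block_index
begin

lemma glueI:
  "v \<in> open_simplex T \<Longrightarrow> (\<And>t. t \<in> T \<Longrightarrow> q t \<in> N) \<Longrightarrow> assemble (\<lambda>t j. v t * q t j) \<in> glue N"
  unfolding glue_def by blast


text \<open>
  Mixing and gluing commute by Bayes' rule: the blocks of a mixture are mixtures whose weights are the
  conditional probabilities of the hidden state given the block. As these weights may be prescribed
  freely for each block, every choice of mixtures arises.
\<close>

lemma Mixt_glue: "Mixt r (glue N) = glue (Mixt r N)"
proof (intro equalityI subsetI)
  fix x assume "x \<in> Mixt r (glue N)"
  then obtain w p where x: "x = (\<lambda>i. \<Sum>h\<in>{1..r}. w h * p h i)" and w: "w \<in> open_simplex {1..r}"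
    and p: "\<And>h. h \<in> {1..r} \<Longrightarrow> p h \<in> glue N"
    unfolding Mixt_def by blast
  have ne: "{1..r} \<noteq> {}" using open_simplex_sum[OF w] by (cases r) auto
  define P where "P = (\<lambda>h v q. p h = assemble (\<lambda>t j. v t * q t j) \<and> v \<in> open_simplex T \<and> (\<forall>t\<in>T. q t \<in> N))"
  have "\<forall>h\<in>{1..r}. \<exists>v q. P h v q"
    using p unfolding glue_def P_def by blast
  then obtain v q where vq: "\<And>h. h \<in> {1..r} \<Longrightarrow> P h (v h) (q h)"
    by metis
  have ph: "\<And>h. h \<in> {1..r} \<Longrightarrow> p h = assemble (\<lambda>t j. v h t * q h t j)"
    and v: "\<And>h. h \<in> {1..r} \<Longrightarrow> v h \<in> open_simplex T"
    and q: "\<And>h t. h \<in> {1..r} \<Longrightarrow> t \<in> T \<Longrightarrow> q h t \<in> N"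
    using vq unfolding P_def by blast+
  \<comment> \<open>\<open>V\<close> is the distribution of the blocks, and \<open>l t\<close> is the posterior of the hidden state given block \<open>t\<close>.\<close>
  define V where "V = (\<lambda>t. \<Sum>h\<in>{1..r}. w h * v h t)"
  define l where "l = (\<lambda>t h. if h \<in> {1..r} then w h * v h t / V t else 0)"
  define Q where "Q = (\<lambda>t j. \<Sum>h\<in>{1..r}. l t h * q h t j)"
  have wv: "0 < w h * v h t" if "h \<in> {1..r}" "t \<in> T" for h t
    using open_simplex_pos[OF w that(1)] open_simplex_pos[OF v[OF that(1)] that(2)] by simp
  have V_pos: "0 < V t" if "t \<in> T" for t
    unfolding V_def using ne wv that by (intro sum_pos) auto
  have "V \<in> open_simplex T"
  proof (rule open_simplexI[OF V_pos])
    show "V t = 0" if "t \<notin> T" for t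
      unfolding V_def using open_simplex_outside[OF v that] by simp
    have "(\<Sum>t\<in>T. V t) = (\<Sum>h\<in>{1..r}. w h * (\<Sum>t\<in>T. v h t))"
      unfolding V_def by (subst sum.swap) (simp add: sum_distrib_left)
    also have "\<dots> = 1" using open_simplex_sum[OF w] open_simplex_sum[OF v] by simp
    finally show "(\<Sum>t\<in>T. V t) = 1" .
  qed
  moreover have "Q t \<in> Mixt r N" if t: "t \<in> T" for t
  proof -
    have "l t \<in> open_simplex {1..r}"
    proof (rule open_simplexI)
      show "0 < l t h" if "h \<in> {1..r}" for h using wv[OF that t] V_pos[OF t] that by (simp add: l_def)
      show "l t h = 0" if "h \<notin> {1..r}" for h unfolding l_def using that by (simp only: if_False)
      have "(\<Sum>h\<in>{1..r}. l t h) = (\<Sum>h\<in>{1..r}. w h * v h t / V t)"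
        by (intro sum.cong) (auto simp: l_def)
      also have "\<dots> = V t / V t" by (simp only: V_def flip: sum_divide_distrib)
      finally show "(\<Sum>h\<in>{1..r}. l t h) = 1" using V_pos[OF t] by simp
    qed
    then show ?thesis unfolding Q_def using q t by (intro MixtI)
  qed
  moreover have "x = assemble (\<lambda>t j. V t * Q t j)"
  proof
    fix i
    show "x i = assemble (\<lambda>t j. V t * Q t j) i"
    proof (cases "i \<in> I")
      case True
      have "V (\<tau> i) * Q (\<tau> i) (\<rho> i) = (\<Sum>h\<in>{1..r}. w h * (v h (\<tau> i) * q h (\<tau> i) (\<rho> i)))"
        using V_pos[OF \<tau>_in[OF True]] by (simp add: Q_def l_def sum_distrib_left mult.assoc)
      then show ?thesis using True by (simp add: x ph assemble_def)
    qed (simp add: x ph assemble_def)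
  qed
  ultimately show "x \<in> glue (Mixt r N)" by (simp only: glueI)
next
  fix x assume "x \<in> glue (Mixt r N)"
  then obtain V Q where x: "x = assemble (\<lambda>t j. V t * Q t j)" and V: "V \<in> open_simplex T"
    and Q: "\<And>t. t \<in> T \<Longrightarrow> Q t \<in> Mixt r N" unfolding glue_def by blast
  define P where "P = (\<lambda>t l q. Q t = (\<lambda>j. \<Sum>h\<in>{1..r}. l h * q h j) \<and> l \<in> open_simplex {1..r} \<and>
      (\<forall>h\<in>{1..r}. q h \<in> N))"
  have "\<forall>t\<in>T. \<exists>l q. P t l q"
    using Q unfolding Mixt_def P_def by blast
  then obtain l q where lq: "\<And>t. t \<in> T \<Longrightarrow> P t (l t) (q t)"
    by metis
  have Qt: "\<And>t. t \<in> T \<Longrightarrow> Q t = (\<lambda>j. \<Sum>h\<in>{1..r}. l t h * q t h j)"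
    and l: "\<And>t. t \<in> T \<Longrightarrow> l t \<in> open_simplex {1..r}"
    and q: "\<And>h t. t \<in> T \<Longrightarrow> h \<in> {1..r} \<Longrightarrow> q t h \<in> N"
    using lq unfolding P_def by blast+
  \<comment> \<open>Bayes in the other direction: \<open>w\<close> is the prior of the hidden state, \<open>v h\<close> the blocks given \<open>h\<close>.\<close>
  define w where "w = (\<lambda>h. \<Sum>t\<in>T. V t * l t h)"
  define v where "v = (\<lambda>h t. V t * l t h / w h)"
  have Vl: "0 < V t * l t h" if "t \<in> T" "h \<in> {1..r}" for t h
    using open_simplex_pos[OF V that(1)] open_simplex_pos[OF l[OF that(1)] that(2)] by simp
  have w_pos: "0 < w h" if "h \<in> {1..r}" for h
    unfolding w_def using Vl that finite_T T_nonempty by (intro sum_pos) auto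
  have "w \<in> open_simplex {1..r}"
  proof (rule open_simplexI[OF w_pos])
    show "w h = 0" if "h \<notin> {1..r}" for h
      unfolding w_def using open_simplex_outside[OF l that] by simp
    have "(\<Sum>h\<in>{1..r}. w h) = (\<Sum>t\<in>T. V t * (\<Sum>h\<in>{1..r}. l t h))"
      unfolding w_def by (subst sum.swap) (simp add: sum_distrib_left)
    also have "\<dots> = 1" using open_simplex_sum[OF V] open_simplex_sum[OF l] by simp
    finally show "(\<Sum>h\<in>{1..r}. w h) = 1" .
  qed
  moreover have "assemble (\<lambda>t j. v h t * q t h j) \<in> glue N" if h: "h \<in> {1..r}" for h
  proof -
    have "v h \<in> open_simplex T"
    proof (rule open_simplexI)
      show "0 < v h t" if "t \<in> T" for t using Vl[OF that h] w_pos[OF h] by (simp add: v_def)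
      show "v h t = 0" if "t \<notin> T" for t using open_simplex_outside[OF V that] by (simp add: v_def)
      have "(\<Sum>t\<in>T. v h t) = w h / w h" by (simp only: v_def w_def flip: sum_divide_distrib)
      then show "(\<Sum>t\<in>T. v h t) = 1" using w_pos[OF h] by simp
    qed
    then show ?thesis using q h by (intro glueI)
  qed
  moreover have "x = (\<lambda>i. \<Sum>h\<in>{1..r}. w h * assemble (\<lambda>t j. v h t * q t h j) i)"
  proof
    fix i
    show "x i = (\<Sum>h\<in>{1..r}. w h * assemble (\<lambda>t j. v h t * q t h j) i)"
    proof (cases "i \<in> I")
      case True
      have "V (\<tau> i) * Q (\<tau> i) (\<rho> i) = (\<Sum>h\<in>{1..r}. w h * (v h (\<tau> i) * q (\<tau> i) h (\<rho> i)))"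
        unfolding Qt[OF \<tau>_in[OF True]] sum_distrib_left
      proof (rule sum.cong[OF refl])
        fix h assume "h \<in> {1..r}"
        from w_pos[OF this]
        show "V (\<tau> i) * (l (\<tau> i) h * q (\<tau> i) h (\<rho> i)) = w h * (v h (\<tau> i) * q (\<tau> i) h (\<rho> i))"
          by (simp add: v_def)
      qed
      then show ?thesis using True by (simp add: x assemble_def)
    qed (simp add: x assemble_def)
  qed
  ultimately show "x \<in> Mixt r (glue N)"
    by (simp only: MixtI)
qed

end

section \<open>Clique stars\<close>

lemma finite_states: "finite A \<Longrightarrow> finite (states d A)"
  unfolding states_def by (rule finite_PiE) auto

lemma card_states: "finite A \<Longrightarrow> card (states d A) = num_states d A"
  unfolding states_def num_states_def by (subst card_PiE) auto

lemma states_nonempty: "(\<And>v. v \<in> A \<Longrightarrow> 1 \<le> d v) \<Longrightarrow> states d A \<noteq> {}"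
  unfolding states_def by (auto simp: PiE_eq_empty_iff Suc_le_eq)

lemma restrict_states: "i \<in> states d A \<Longrightarrow> B \<subseteq> A \<Longrightarrow> restrict i B \<in> states d B"
  unfolding states_def by (auto simp: PiE_iff)

locale clique_star_model =
  fixes V :: "'v set" and E :: "'v set set" and d :: "'v \<Rightarrow> nat"
    and k :: nat and D C :: "nat \<Rightarrow> 'v set" and S :: "'v set"
  assumes graph: "simple_graph V E"
    and star: "clique_star V E k D S"
    and C_def: "\<And>j. j \<in> {1..k} \<Longrightarrow> C j = D j - S"
    and d_pos: "\<And>v. v \<in> V \<Longrightarrow> 1 \<le> d v"
begin

lemma finite_V: "finite V" using graph by (simp add: simple_graph_def)

lemma D_bij: "bij_betw D {1..k} (maximal_cliques V E)"
  and V_eq: "V = (\<Union>j\<in>{1..k}. D j)"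
  and S_clique: "clique V E S"
  and D_inter: "\<And>i j. i \<in> {1..k} \<Longrightarrow> j \<in> {1..k} \<Longrightarrow> i \<noteq> j \<Longrightarrow> D i \<inter> D j = S"
  using star unfolding clique_star_def by blast+

lemma S_sub_V: "S \<subseteq> V" using S_clique by (simp add: clique_def)

lemma D_sub_V: "j \<in> {1..k} \<Longrightarrow> D j \<subseteq> V" using V_eq by blast

text \<open>The graph without vertices has the maximal clique \<open>{}\<close>.\<close>

lemma k_pos: "1 \<le> k"
proof (rule ccontr)
  assume "\<not> 1 \<le> k"
  then have k: "{1..k} = {}" by simp
  then have "V = {}" using V_eq by simp
  then have "{} \<in> maximal_cliques V E" by (auto simp: maximal_cliques_def clique_def)
  then show False using D_bij k by (simp add: bij_betw_def)
qed

lemma S_sub_D: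
  assumes j: "j \<in> {1..k}"
  shows "S \<subseteq> D j"
proof (cases "\<exists>j'\<in>{1..k}. j' \<noteq> j")
  case True
  then show ?thesis using D_inter j by blast
next
  case False
  then have "{1..k} = {j}" using j by blast
  then have "V = D j" using V_eq by simp
  then show ?thesis using S_sub_V by simp
qed

lemma D_eq: "j \<in> {1..k} \<Longrightarrow> D j = S \<union> C j"
  using S_sub_D C_def by blast

lemma C_sub_V: "j \<in> {1..k} \<Longrightarrow> C j \<subseteq> V" using D_eq D_sub_V by blast

lemma finite_S: "finite S" using finite_subset[OF S_sub_V finite_V] .

lemma finite_C: "j \<in> {1..k} \<Longrightarrow> finite (C j)" using finite_subset[OF C_sub_V finite_V] .

lemma V_decomp: "V = S \<union> (\<Union>j\<in>{1..k}. C j)"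
proof -
  have "1 \<in> {1..k}" using k_pos by simp
  then have "(\<Union>j\<in>{1..k}. D j) = S \<union> (\<Union>j\<in>{1..k}. C j)" using D_eq by blast
  then show ?thesis using V_eq by simp
qed

lemma C_disjoint: "i \<in> {1..k} \<Longrightarrow> j \<in> {1..k} \<Longrightarrow> i \<noteq> j \<Longrightarrow> C i \<inter> C j = {}"
  using D_inter C_def by blast

lemma S_C_disjoint: "j \<in> {1..k} \<Longrightarrow> S \<inter> C j = {}" using C_def by blast

definition n :: "nat \<Rightarrow> nat" where "n = (\<lambda>j. num_states d (C j))"

text \<open>
  The joint state of the vertices in \<open>C j\<close>, numbered from \<open>1\<close> to \<open>n j\<close>, is the state of the \<open>j\<close>th variable of the
  independence model. The numbering is arbitrary.
\<close>

definition \<beta> :: "nat \<Rightarrow> ('v \<Rightarrow> nat) \<Rightarrow> nat" where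
  "\<beta> j = (SOME f. bij_betw f (states d (C j)) {1..n j})"

lemma \<beta>_bij: "j \<in> {1..k} \<Longrightarrow> bij_betw (\<beta> j) (states d (C j)) {1..n j}"
  unfolding \<beta>_def
  by (rule someI_ex[OF finite_same_card_bij])
    (simp_all add: finite_states finite_C card_states n_def)

definition \<rho> :: "('v \<Rightarrow> nat) \<Rightarrow> nat \<Rightarrow> nat" where
  "\<rho> i = (\<lambda>j\<in>{1..k}. \<beta> j (restrict i (C j)))"

lemma \<rho>_states: "i \<in> states d V \<Longrightarrow> \<rho> i \<in> states n {1..k}"
  unfolding \<rho>_def states_def[of n]
proof (rule restrict_PiE_iff[THEN iffD2], rule ballI)
  fix j assume i: "i \<in> states d V" and j: "j \<in> {1..k}"
  show "\<beta> j (restrict i (C j)) \<in> {1..n j}"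
    by (rule bij_betw_apply[OF \<beta>_bij[OF j] restrict_states[OF i C_sub_V[OF j]]])
qed

lemma n_pos: "j \<in> {1..k} \<Longrightarrow> 1 \<le> n j"
  unfolding n_def num_states_def using d_pos C_sub_V by (intro prod_ge_1) blast

lemma card_states_V: "card (states d V) = card (states d S) * card (states n {1..k})"
proof -
  have fin: "finite (\<Union>j\<in>{1..k}. C j)" using finite_C by blast
  have "num_states d V = num_states d S * (\<Prod>v\<in>(\<Union>j\<in>{1..k}. C j). d v)"
    unfolding num_states_def using S_C_disjoint
    by (subst V_decomp, intro prod.union_disjoint finite_S fin) blast
  also have "(\<Prod>v\<in>(\<Union>j\<in>{1..k}. C j). d v) = (\<Prod>j\<in>{1..k}. \<Prod>v\<in>C j. d v)"
    using finite_C C_disjoint by (intro prod.UNION_disjoint) auto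
  also have "\<dots> = num_states n {1..k}" by (simp add: num_states_def n_def)
  finally show ?thesis by (simp add: card_states finite_V finite_S)
qed

lemma states_bij:
  "bij_betw (\<lambda>i. (restrict i S, \<rho> i)) (states d V) (states d S \<times> states n {1..k})"
proof -
  have inj: "inj_on (\<lambda>i. (restrict i S, \<rho> i)) (states d V)"
  proof (rule inj_onI)
    fix i i' assume i: "i \<in> states d V" "i' \<in> states d V"
      and eq: "(restrict i S, \<rho> i) = (restrict i' S, \<rho> i')"
    have eqC: "restrict i (C j) = restrict i' (C j)" if j: "j \<in> {1..k}" for j
    proof (rule inj_onD[OF bij_betw_imp_inj_on[OF \<beta>_bij[OF j]]])
      have "\<rho> i j = \<rho> i' j" using eq by simp
      then show "\<beta> j (restrict i (C j)) = \<beta> j (restrict i' (C j))" using j by (simp add: \<rho>_def)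
    qed (use i restrict_states C_sub_V[OF j] in blast)+
    show "i = i'"
    proof (rule PiE_ext[OF i[unfolded states_def]])
      fix v assume "v \<in> V"
      then consider "v \<in> S" | j where "j \<in> {1..k}" "v \<in> C j" using V_decomp by blast
      then show "i v = i' v"
      proof cases
        case 1
        have "restrict i S v = restrict i' S v" using eq by simp
        then show ?thesis using 1 by simp
      next
        case 2
        have "restrict i (C j) v = restrict i' (C j) v" using eqC[OF 2(1)] by simp
        then show ?thesis using 2 by simp
      qed
    qed
  qed
  have "(\<lambda>i. (restrict i S, \<rho> i)) ` states d V \<subseteq> states d S \<times> states n {1..k}"
    using restrict_states S_sub_V \<rho>_states by blast
  moreover have "card ((\<lambda>i. (restrict i S, \<rho> i)) ` states d V) = card (states d S \<times> states n {1..k})"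
    by (simp add: card_image[OF inj] card_cartesian_product card_states_V)
  ultimately have "(\<lambda>i. (restrict i S, \<rho> i)) ` states d V = states d S \<times> states n {1..k}"
    by (intro card_subset_eq) (simp_all add: finite_states finite_S)
  then show ?thesis using inj by (simp add: bij_betw_def)
qed

definition J :: "(nat \<Rightarrow> nat) set" where "J = states n {1..k}"

sublocale block_index "states d V" "states d S" J "\<lambda>i. restrict i S" \<rho>
proof
  show "finite (states d S)" by (rule finite_states[OF finite_S])
  show "finite J" unfolding J_def by (rule finite_states) (rule finite_atLeastAtMost)
  show "states d S \<noteq> {}" by (rule states_nonempty) (use d_pos S_sub_V in blast)
  show "J \<noteq> {}" unfolding J_def by (rule states_nonempty) (rule n_pos)
  show "bij_betw (\<lambda>i. (restrict i S, \<rho> i)) (states d V) (states d S \<times> J)"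
    unfolding J_def by (rule states_bij)
qed

lemma prod_maximal_cliques: "(\<Prod>B\<in>maximal_cliques V E. F B) = (\<Prod>j\<in>{1..k}. F (D j))"
  by (rule prod.reindex_bij_betw[OF D_bij, symmetric])

text \<open>The state on a maximal clique, recovered from its parts on \<open>S\<close> and on \<open>C j\<close>.\<close>

definition clique_state :: "('v \<Rightarrow> nat) \<Rightarrow> nat \<Rightarrow> nat \<Rightarrow> 'v \<Rightarrow> nat" where
  "clique_state t j y = (\<lambda>v. if v \<in> S then t v else inv_into (states d (C j)) (\<beta> j) y v)"

lemma clique_state_restrict:
  assumes i: "i \<in> states d V" and j: "j \<in> {1..k}"
  shows "clique_state (restrict i S) j (\<rho> i j) = restrict i (D j)"
proof -
  have "restrict i (C j) \<in> states d (C j)" using restrict_states[OF i C_sub_V[OF j]] .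
  then have "inv_into (states d (C j)) (\<beta> j) (\<rho> i j) = restrict i (C j)"
    using j inv_into_f_f[OF bij_betw_imp_inj_on[OF \<beta>_bij[OF j]]] by (simp add: \<rho>_def)
  then show ?thesis by (auto simp: clique_state_def D_eq[OF j] fun_eq_iff)
qed

text \<open>
  A scalar factor of a rank one tensor can be moved into its first factor, as there is at least one.
\<close>

lemma prod_first_factor:
  fixes c :: "'a::comm_monoid_mult"
  shows "(\<Prod>j\<in>{1..k}. (if j = 1 then c else 1) * f j) = c * (\<Prod>j\<in>{1..k}. f j)"
  using k_pos by (simp add: prod.distrib)

lemma independence_model_eq: "independence_model k n =
    {q \<in> open_simplex J. \<exists>a :: nat \<Rightarrow> nat \<Rightarrow> real. \<forall>y\<in>J. q y = (\<Prod>j\<in>{1..k}. a j (y j))}"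
  by (simp only: independence_model_def J_def)

lemma independence_subset: "independence_model k n \<subseteq> open_simplex J"
  unfolding independence_model_eq by blast

text \<open>
  With the state \<open>t\<close> on \<open>S\<close> fixed, each clique potential is a function of the state on one \<open>C j\<close>, so the
  block of \<open>t\<close> is a rank one tensor up to its mass. Complex potentials may be replaced by their absolute
  values, because the product is positive.
\<close>

lemma graphical_subset_glue: "graphical_model V E d \<subseteq> glue (independence_model k n)"
proof
  fix p assume "p \<in> graphical_model V E d"
  then obtain \<theta> where p: "p \<in> open_simplex (states d V)"
    and \<theta>: "\<And>i. i \<in> states d V \<Longrightarrow> complex_of_real (p i) = monomial_map V E \<theta> i"
    unfolding graphical_model_def by blast
  define w where "w = (\<lambda>t. if t \<in> states d S then mass t p else 0)"
  define q where "q = (\<lambda>t y. block t p y / w t)"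
  \<comment> \<open>The division by \<open>w t\<close> normalises the block; it is assigned to the first factor.\<close>
  define a where "a = (\<lambda>t j y. (if j = 1 then 1 / w t else 1) * cmod (\<theta> (D j) (clique_state t j y)))"
  have block_pos: "0 < block t p y" if "t \<in> states d S" "y \<in> J" for t y
    using open_simplex_pos[OF p block_index_at(1)[OF that]] that by (simp add: block_def)
  have w_pos: "0 < w t" if "t \<in> states d S" for t
    unfolding w_def mass_def using that block_pos finite_J J_nonempty by (simp add: sum_pos)
  have w: "w \<in> open_simplex (states d S)"
  proof (rule open_simplexI[OF w_pos])
    have "(\<Sum>t\<in>states d S. w t) = (\<Sum>t\<in>states d S. mass t p)" by (simp add: w_def)
    then show "(\<Sum>t\<in>states d S. w t) = 1" using open_simplex_sum[OF p] by (simp add: sum_mass)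
  qed (simp_all add: w_def)
  have p_prod: "p i = (\<Prod>j\<in>{1..k}. cmod (\<theta> (D j) (clique_state (restrict i S) j (\<rho> i j))))"
    if i: "i \<in> states d V" for i
  proof -
    have "p i = cmod (complex_of_real (p i))" using open_simplex_pos[OF p i] by simp
    also have "\<dots> = (\<Prod>j\<in>{1..k}. cmod (\<theta> (D j) (restrict i (D j))))"
      unfolding \<theta>[OF i] monomial_map_def prod_maximal_cliques by (simp add: prod_norm)
    also have "\<dots> = (\<Prod>j\<in>{1..k}. cmod (\<theta> (D j) (clique_state (restrict i S) j (\<rho> i j))))"
      by (intro prod.cong refl) (simp only: clique_state_restrict[OF i])
    finally show ?thesis .
  qed
  have "q t \<in> independence_model k n" if t: "t \<in> states d S" for t
  proof -
    have "q t \<in> open_simplex (J)"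
    proof (rule open_simplexI)
      show "0 < q t y" if "y \<in> J" for y
        using block_pos[OF t that] w_pos[OF t] by (simp add: q_def)
      show "q t y = 0" if "y \<notin> J" for y using that by (simp add: q_def block_def)
      have "(\<Sum>y\<in>J. q t y) = mass t p / w t"
        unfolding q_def mass_def by (simp add: sum_divide_distrib)
      then show "(\<Sum>y\<in>J. q t y) = 1" using t w_pos[OF t] by (simp add: w_def)
    qed
    moreover have "q t y = (\<Prod>j\<in>{1..k}. a t j (y j))" if y: "y \<in> J" for y
    proof -
      let ?i = "inv_into (states d V) (\<lambda>i. (restrict i S, \<rho> i)) (t, y)"
      have "q t y = 1 / w t * p ?i" using y by (simp add: q_def block_def)
      also have "p ?i = (\<Prod>j\<in>{1..k}. cmod (\<theta> (D j) (clique_state t j (y j))))"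
        using p_prod[OF block_index_at(1)[OF t y]] by (simp only: block_index_at[OF t y])
      also have "1 / w t * \<dots> = (\<Prod>j\<in>{1..k}. a t j (y j))"
        unfolding a_def by (rule prod_first_factor[symmetric])
      finally show ?thesis .
    qed
    ultimately show ?thesis unfolding independence_model_eq by blast
  qed
  then have "assemble (\<lambda>t y. w t * q t y) \<in> glue (independence_model k n)"
    by (intro glueI[OF w])
  moreover have "assemble (\<lambda>t y. w t * q t y) = assemble (\<lambda>t. block t p)"
    by (rule assemble_cong) (use w_pos in \<open>simp add: q_def less_imp_neq[symmetric]\<close>)
  moreover have "assemble (\<lambda>t. block t p) = p"
    by (rule assemble_block[OF open_simplex_outside[OF p]])
  ultimately show "p \<in> glue (independence_model k n)" by simp
qed


text \<open>
  Conversely, the potential of the first clique absorbs the weights, which depend on the state on \<open>S\<close> only.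
\<close>

lemma glue_subset_graphical: "glue (independence_model k n) \<subseteq> graphical_model V E d"
proof
  fix p assume p: "p \<in> glue (independence_model k n)"
  then have simplex: "p \<in> open_simplex (states d V)"
    using glue_subset_simplex[OF independence_subset] by blast
  obtain w q where p_eq: "p = assemble (\<lambda>t y. w t * q t y)"
    and q: "\<forall>t\<in>states d S. q t \<in> independence_model k n"
    using p unfolding glue_def by blast
  have "\<forall>t\<in>states d S. \<exists>a. \<forall>y\<in>J. q t y = (\<Prod>j\<in>{1..k}. a j (y j))"
    using q unfolding independence_model_eq by blast
  then obtain a :: "('v \<Rightarrow> nat) \<Rightarrow> nat \<Rightarrow> nat \<Rightarrow> real" where
    a: "\<forall>t\<in>states d S. \<forall>y\<in>J. q t y = (\<Prod>j\<in>{1..k}. a t j (y j))"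
    unfolding bchoice_iff by blast
  define \<eta> where "\<eta> = (\<lambda>j z. (if j = 1 then w (restrict z S) else 1) *
    a (restrict z S) j (\<beta> j (restrict z (C j))))"
  \<comment> \<open>Potentials are indexed by cliques, so the number of the clique has to be recovered from it.\<close>
  define \<theta> where "\<theta> = (\<lambda>B z. complex_of_real (\<eta> (inv_into {1..k} D B) z))"
  have "complex_of_real (p i) = monomial_map V E \<theta> i" if i: "i \<in> states d V" for i
  proof -
    have \<theta>_eq: "\<theta> (D j) (restrict i (D j)) =
        of_real ((if j = 1 then w (restrict i S) else 1) * a (restrict i S) j (\<rho> i j))"
      if j: "j \<in> {1..k}" for j
    proof -
      have "inv_into {1..k} D (D j) = j"
        using inv_into_f_f[OF bij_betw_imp_inj_on[OF D_bij] j] .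
      moreover have "D j \<inter> S = S" "D j \<inter> C j = C j" using D_eq[OF j] by auto
      ultimately show ?thesis
        by (simp only: \<theta>_def \<eta>_def \<rho>_def restrict_restrict restrict_apply'[OF j])
    qed
    have "p i = w (restrict i S) * q (restrict i S) (\<rho> i)" using i by (simp add: p_eq assemble_def)
    also have "q (restrict i S) (\<rho> i) = (\<Prod>j\<in>{1..k}. a (restrict i S) j (\<rho> i j))"
      using a \<tau>_in[OF i] \<rho>_in[OF i] by blast
    also have "w (restrict i S) * \<dots> =
        (\<Prod>j\<in>{1..k}. (if j = 1 then w (restrict i S) else 1) * a (restrict i S) j (\<rho> i j))"
      by (rule prod_first_factor[symmetric])
    finally have "complex_of_real (p i) = (\<Prod>j\<in>{1..k}. \<theta> (D j) (restrict i (D j)))"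
      by (simp add: \<theta>_eq)
    then show ?thesis unfolding monomial_map_def prod_maximal_cliques .
  qed
  then show "p \<in> graphical_model V E d"
    using simplex unfolding graphical_model_def by blast
qed

lemma graphical_eq_glue: "graphical_model V E d = glue (independence_model k n)"
  using graphical_subset_glue glue_subset_graphical by (rule equalityI)

end

theorem theorem5p2:
  fixes V :: "'v set" and E :: "'v set set" and d :: "'v \<Rightarrow> nat"
    and k r :: nat and D C :: "nat \<Rightarrow> 'v set" and S :: "'v set"
  assumes "simple_graph V E"
    and "clique_star V E k D S"
    and "\<And>j. j \<in> {1..k} \<Longrightarrow> C j = D j - S"
    and "\<And>v. v \<in> V \<Longrightarrow> d v \<ge> 1"
    and "r \<ge> 1"
  shows "MLdeg (states d V) (Mixt r (graphical_model V E d)) =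
    (MLdeg (states (\<lambda>j. num_states d (C j)) {1..k})
       (Mixt r (independence_model k (\<lambda>j. num_states d (C j))))) ^ num_states d S"
proof -
  interpret clique_star_model V E d k D C S
    using assms(1-4) by unfold_locales
  interpret mixture: glued_model "states d V" "states d S" J "\<lambda>i. restrict i S" \<rho>
    "Mixt r (independence_model k n)"
    by unfold_locales (rule Mixt_subset_simplex[OF independence_subset])
  have "Mixt r (graphical_model V E d) = glue (Mixt r (independence_model k n))"
    unfolding graphical_eq_glue by (rule Mixt_glue)
  then show ?thesis
    using mixture.MLdeg_glue by (simp only: card_states[OF finite_S] n_def J_def)
qed

end
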